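(* Let $T\prec Z$ in $s$-weak order, and let $(a_1,b_1),\dots,(a_l,b_l)$ be the tree ascents $(a_i,b_i)$ of $T$ such that $(b_i,a_i)\in\mathrm{inv}(Z)-\mathrm{inv}(T)$. Then the order complex $\Delta(T,Z)$ of the open interval $(T,Z)$ is homotopy equivalent to a sphere if and only if $$\mathrm{inv}(Z)=\big(\mathrm{inv}(T)+A_T(a_1,b_1)+\dots+A_T(a_l,b_l)\big)^{tc}.$$ Moreover, in this case the dimension of the sphere is $l-2$.
   Context: A weak composition is a sequence $s=(s(1),\dots,s(n))$ of nonnegative integers. An $s$-decreasing tree is a planar rooted tree $T$ whose internal vertices are labeled bijectively by $1,\dots,n$ (leaves unlabeled), such that internal vertex $i$ has exactly $s(i)+1$ children, indexed $0,\dots,s(i)$ from left to right, and every labeled descendant of $i$ has smaller label. $T^i$ is the full subtree rooted at $i$, $T^i_j$ the full subtree rooted at the $j$-th child of $i$. For $1\le x<y\le n$, $\#_T(y,x)$ is: $0$ if $x$ is left of $y$ in $T$ or $x\in T^y_0$; $i$ if $x\in T^y_i$ with $0<i<s(y)$; $s(y)$ if $x\in T^y_{s(y)}$ or $x$ is right of $y$. A multi-inversion set is a multiset $I$ of pairs $(y,x)$, $1\le x<y\le n$, with multiplicities $\#_I(y,x)$; $\mathrm{inv}(T)$ has multiplicities $\#_T(y,x)$. $I\subseteq J$ is multiplicity-wise inclusion; $J-I$ has multiplicities $\max(\#_J-\#_I,0)$; $I\cup J$ has multiplicities $\max(\#_I,\#_J)$; $I+J$ has multiplicities $\min(\#_I(y,x)+\#_J(y,x),s(y))$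 (an ordinary set of pairs is regarded as a multi-inversion set with multiplicities $1$), and $I+(b,a)=I+\{(b,a)\}$. $I$ is transitive if for all $a<b<c$ with $\#_I(c,b)=i$, either $\#_I(b,a)=0$ or $\#_I(c,a)\ge i$; $I^{tc}$ is the smallest transitive multi-inversion set containing $I$. $s$-weak order: $T\preceq Z$ iff $\mathrm{inv}(T)\subseteq\mathrm{inv}(Z)$; it is a lattice. For $a<b$, $(a,b)$ is a tree ascent of $T$ if (i) $a\in T^b_i$ for some $0\le i<s(b)$; (ii) whenever $a<e<b$ and $a\in T^e_j$, then $j=s(e)$; (iii) if $s(a)>0$ then $T^a_{s(a)}$ is a leaf. For a tree ascent $(a,b)$ the $s$-tree rotation of $T$ along $(a,b)$ is the unique $s$-decreasing tree $Z'$ with $\mathrm{inv}(Z')=(\mathrm{inv}(T)+(b,a))^{tc}$, and $A_T(a,b)=\{(f,e): \#_{Z'}(f,e)>\#_T(f,e)\}$ (an ordinary set). *)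

theory Defs
  imports "HOL-Analysis.Analysis" "HOL-Library.Multiset"
begin

section \<open>Decreasing trees\<close>

text \<open>
  A weak composition of length \<open>n\<close> is given by \<open>n\<close> and a function \<open>s\<close> of which only the values
  \<open>s 1, \<dots>, s n\<close> are ever used.
\<close>

datatype ltree = Leaf | Node nat "ltree list"

fun labels :: "ltree \<Rightarrow> nat list" where
  "labels Leaf = []"
| "labels (Node i ts) = i # concat (map labels ts)"

fun subtrees :: "ltree \<Rightarrow> ltree set" where
  "subtrees Leaf = {Leaf}"
| "subtrees (Node i ts) = insert (Node i ts) (\<Union>t\<in>set ts. subtrees t)"

definition decreasing_tree :: "nat \<Rightarrow> (nat \<Rightarrow> nat) \<Rightarrow> ltree \<Rightarrow> bool" where
  "decreasing_tree n s T \<longleftrightarrow>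
     distinct (labels T) \<and> set (labels T) = {1..n} \<and>
     (\<forall>i ts. Node i ts \<in> subtrees T \<longrightarrow>
        length ts = s i + 1 \<and> (\<forall>t\<in>set ts. \<forall>x\<in>set (labels t). x < i))"

text \<open>
  \<open>child T i j\<close> is the tree written \<open>T\<^sup>i\<^sub>j\<close>; it is meaningful when \<open>i\<close> is a label of \<open>T\<close> and
  \<open>j \<le> s i\<close>.
\<close>

definition children :: "ltree \<Rightarrow> nat \<Rightarrow> ltree list" where
  "children T i = (THE ts. Node i ts \<in> subtrees T)"

definition child :: "ltree \<Rightarrow> nat \<Rightarrow> nat \<Rightarrow> ltree" where
  "child T i j = children T i ! j"

definition left_of :: "ltree \<Rightarrow> nat \<Rightarrow> nat \<Rightarrow> bool" where
  "left_of T x y \<longleftrightarrow>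
     (\<exists>i ts p q. Node i ts \<in> subtrees T \<and> p < q \<and> q < length ts \<and>
        x \<in> set (labels (ts ! p)) \<and> y \<in> set (labels (ts ! q)))"

definition inv_num :: "(nat \<Rightarrow> nat) \<Rightarrow> ltree \<Rightarrow> nat \<Rightarrow> nat \<Rightarrow> nat" where
  "inv_num s T y x =
     (if left_of T x y \<or> x \<in> set (labels (child T y 0)) then 0
      else if left_of T y x \<or> x \<in> set (labels (child T y (s y))) then s y
      else (THE i. 0 < i \<and> i < s y \<and> x \<in> set (labels (child T y i))))"

section \<open>Multi-inversion sets\<close>

definition inv_pairs :: "nat \<Rightarrow> (nat \<times> nat) set" where
  "inv_pairs n = {(y, x). 1 \<le> x \<and> x < y \<and> y \<le> n}"

definition multi_inv_set :: "nat \<Rightarrow> (nat \<times> nat) multiset \<Rightarrow> bool" where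
  "multi_inv_set n I \<longleftrightarrow> set_mset I \<subseteq> inv_pairs n"

definition tree_inv :: "nat \<Rightarrow> (nat \<Rightarrow> nat) \<Rightarrow> ltree \<Rightarrow> (nat \<times> nat) multiset" where
  "tree_inv n s T = (\<Sum>(y, x)\<in>inv_pairs n. replicate_mset (inv_num s T y x) (y, x))"

definition max_inv :: "nat \<Rightarrow> (nat \<Rightarrow> nat) \<Rightarrow> (nat \<times> nat) multiset" where
  "max_inv n s = (\<Sum>(y, x)\<in>inv_pairs n. replicate_mset (s y) (y, x))"

text \<open>The sum whose multiplicities are cut off at \<open>s y\<close>; intersecting takes the minimum.\<close>

definition inv_plus ::
  "nat \<Rightarrow> (nat \<Rightarrow> nat) \<Rightarrow> (nat \<times> nat) multiset \<Rightarrow> (nat \<times> nat) multiset \<Rightarrow> (nat \<times> nat) multiset" where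
  "inv_plus n s I J = (I + J) \<inter># max_inv n s"

definition inv_transitive :: "nat \<Rightarrow> (nat \<times> nat) multiset \<Rightarrow> bool" where
  "inv_transitive n I \<longleftrightarrow>
     (\<forall>a b c. 1 \<le> a \<and> a < b \<and> b < c \<and> c \<le> n \<longrightarrow>
        count I (b, a) = 0 \<or> count I (c, b) \<le> count I (c, a))"

definition is_inv_tc :: "nat \<Rightarrow> (nat \<times> nat) multiset \<Rightarrow> (nat \<times> nat) multiset \<Rightarrow> bool" where
  "is_inv_tc n I J \<longleftrightarrow>
     multi_inv_set n J \<and> inv_transitive n J \<and> I \<subseteq># J \<and>
     (\<forall>K. multi_inv_set n K \<and> inv_transitive n K \<and> I \<subseteq># K \<longrightarrow> J \<subseteq># K)"

definition inv_tc :: "nat \<Rightarrow> (nat \<times> nat) multiset \<Rightarrow> (nat \<times> nat) multiset" where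
  "inv_tc n I = (THE J. is_inv_tc n I J)"

lemma finite_inv_pairs: "finite (inv_pairs n)"
  by (rule finite_subset[of _ "{..n} \<times> {..n}"]) (auto simp: inv_pairs_def)

lemma count_sum_replicate_mset:
  assumes "finite A"
  shows "count (\<Sum>p\<in>A. replicate_mset (f p) p) q = (if q \<in> A then f q else 0)"
  using assms by (simp add: count_sum)

lemma count_tree_inv:
  "count (tree_inv n s T) (y, x) = (if (y, x) \<in> inv_pairs n then inv_num s T y x else 0)"
proof -
  have "tree_inv n s T = (\<Sum>p\<in>inv_pairs n. replicate_mset (inv_num s T (fst p) (snd p)) p)"
    unfolding tree_inv_def by (simp add: case_prod_unfold)
  then show ?thesis
    by (simp add: count_sum_replicate_mset finite_inv_pairs)
qed

lemma count_max_inv: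
  "count (max_inv n s) (y, x) = (if (y, x) \<in> inv_pairs n then s y else 0)"
proof -
  have "max_inv n s = (\<Sum>p\<in>inv_pairs n. replicate_mset (s (fst p)) p)"
    unfolding max_inv_def by (simp add: case_prod_unfold)
  then show ?thesis
    by (simp add: count_sum_replicate_mset finite_inv_pairs)
qed

lemma is_inv_tc_inv_tc:
  assumes "multi_inv_set n I"
  shows "is_inv_tc n I (inv_tc n I)"
proof -
  define S where "S = {K. multi_inv_set n K \<and> inv_transitive n K \<and> I \<subseteq># K}"
  define M where "M = (\<Sum>p\<in>inv_pairs n. replicate_mset (size I) p)"
  have cM: "count M q = (if q \<in> inv_pairs n then size I else 0)" for q
    unfolding M_def by (rule count_sum_replicate_mset[OF finite_inv_pairs])
  have "M \<in> S"
  proof -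
    have "set_mset M \<subseteq> inv_pairs n"
      using cM by (metis count_eq_zero_iff subsetI)
    moreover have "inv_transitive n M"
      by (auto simp: inv_transitive_def cM inv_pairs_def)
    moreover have "count I q \<le> count M q" for q
    proof (cases "q \<in># I")
      case True
      then have "q \<in> inv_pairs n"
        using assms by (auto simp: multi_inv_set_def)
      then show ?thesis by (simp add: cM count_le_size)
    next
      case False
      then show ?thesis by (simp add: not_in_iff)
    qed
    ultimately show ?thesis
      by (simp add: S_def multi_inv_set_def subseteq_mset_def)
  qed
  then have ne: "S \<noteq> {}" by auto
  define J where "J = Inf S"
  have cJ: "count J q = (INF K\<in>S. count K q)" for q
    unfolding J_def by (rule count_Inf_multiset_nonempty[OF ne])
  have Jle: "J \<subseteq># K" if "K \<in> S" for K
    using that by (simp add: subseteq_mset_def cJ wellorder_Inf_le1)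
  have IJ: "I \<subseteq># J"
    using ne by (auto simp: subseteq_mset_def cJ S_def intro!: cINF_greatest)
  have trJ: "inv_transitive n J"
    unfolding inv_transitive_def
  proof (intro allI impI)
    fix a b c assume abc: "1 \<le> a \<and> a < b \<and> b < c \<and> c \<le> n"
    show "count J (b, a) = 0 \<or> count J (c, b) \<le> count J (c, a)"
    proof (cases "count J (b, a) = 0")
      case False
      have "count J (c, b) \<le> count K (c, a)" if "K \<in> S" for K
      proof -
        have "count J (b, a) \<le> count K (b, a)" "count J (c, b) \<le> count K (c, b)"
          using Jle[OF that] by (auto simp: subseteq_mset_def)
        moreover have "count K (b, a) = 0 \<or> count K (c, b) \<le> count K (c, a)"
          using that abc by (auto simp: S_def inv_transitive_def)
        ultimately show ?thesis using False by linarith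
      qed
      then have "count J (c, b) \<le> count J (c, a)"
        using ne unfolding cJ[of "(c, a)"] by (intro cINF_greatest) auto
      then show ?thesis ..
    qed simp
  qed
  have miJ: "multi_inv_set n J"
    using Jle[OF \<open>M \<in> S\<close>] \<open>M \<in> S\<close> set_mset_mono[of J M]
    by (auto simp: S_def multi_inv_set_def)
  have J: "is_inv_tc n I J"
    using miJ trJ IJ Jle by (auto simp: is_inv_tc_def S_def)
  have "K = J" if "is_inv_tc n I K" for K
    using that J unfolding is_inv_tc_def by (meson subset_mset.antisym)
  then show ?thesis
    unfolding inv_tc_def using J by (metis theI)
qed

section \<open>The weak order and tree rotations\<close>

definition weak_le :: "nat \<Rightarrow> (nat \<Rightarrow> nat) \<Rightarrow> ltree \<Rightarrow> ltree \<Rightarrow> bool" where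
  "weak_le n s T Z \<longleftrightarrow> tree_inv n s T \<subseteq># tree_inv n s Z"

definition weak_less :: "nat \<Rightarrow> (nat \<Rightarrow> nat) \<Rightarrow> ltree \<Rightarrow> ltree \<Rightarrow> bool" where
  "weak_less n s T Z \<longleftrightarrow> weak_le n s T Z \<and> T \<noteq> Z"

definition open_interval :: "nat \<Rightarrow> (nat \<Rightarrow> nat) \<Rightarrow> ltree \<Rightarrow> ltree \<Rightarrow> ltree set" where
  "open_interval n s T Z =
     {W. decreasing_tree n s W \<and> weak_less n s T W \<and> weak_less n s W Z}"

definition tree_ascent :: "nat \<Rightarrow> (nat \<Rightarrow> nat) \<Rightarrow> ltree \<Rightarrow> nat \<times> nat \<Rightarrow> bool" where
  "tree_ascent n s T = (\<lambda>(a, b).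
     1 \<le> a \<and> a < b \<and> b \<le> n \<and>
     (\<exists>i < s b. a \<in> set (labels (child T b i))) \<and>
     (\<forall>e j. a < e \<and> e < b \<and> j \<le> s e \<and> a \<in> set (labels (child T e j)) \<longrightarrow> j = s e) \<and>
     (s a > 0 \<longrightarrow> child T a (s a) = Leaf))"

definition rotation :: "nat \<Rightarrow> (nat \<Rightarrow> nat) \<Rightarrow> ltree \<Rightarrow> nat \<times> nat \<Rightarrow> ltree" where
  "rotation n s T = (\<lambda>(a, b).
     THE W. decreasing_tree n s W \<and>
       tree_inv n s W = inv_tc n (inv_plus n s (tree_inv n s T) {#(b, a)#}))"

definition rotation_set :: "nat \<Rightarrow> (nat \<Rightarrow> nat) \<Rightarrow> ltree \<Rightarrow> nat \<times> nat \<Rightarrow> (nat \<times> nat) set" where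
  "rotation_set n s T p =
     {q. count (tree_inv n s (rotation n s T p)) q > count (tree_inv n s T) q}"

lemma finite_rotation_set: "finite (rotation_set n s T p)"
  by (rule finite_subset[OF _ finite_set_mset[of "tree_inv n s (rotation n s T p)"]])
    (auto simp: rotation_set_def simp flip: count_greater_zero_iff)

lemma subtree_refl: "T \<in> subtrees T"
  by (cases T) auto

lemma finite_decreasing_trees: "finite {T. decreasing_tree n s T}"
proof -
  define G where "G m = {T. set (labels T) \<subseteq> {..<m} \<and>
    (\<forall>i ts. Node i ts \<in> subtrees T \<longrightarrow>
       length ts = s i + 1 \<and> (\<forall>t\<in>set ts. \<forall>x\<in>set (labels t). x < i))}" for m :: nat
  have fin: "finite (G m)" for m
  proof (induction m rule: less_induct)
    case (less m)
    let ?B = "\<lambda>i. Node i ` {ts. set ts \<subseteq> G i \<and> length ts = s i + 1}"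
    have "G m \<subseteq> insert Leaf (\<Union>i<m. ?B i)"
    proof
      fix T assume T: "T \<in> G m"
      show "T \<in> insert Leaf (\<Union>i<m. ?B i)"
      proof (cases T)
        case (Node i ts)
        have top: "length ts = s i + 1" "\<forall>t\<in>set ts. \<forall>x\<in>set (labels t). x < i"
          using T subtree_refl[of T] unfolding G_def Node by blast+
        have "set ts \<subseteq> G i"
        proof
          fix t assume t: "t \<in> set ts"
          then have "subtrees t \<subseteq> subtrees T" by (auto simp: Node)
          then show "t \<in> G i"
            using T top(2) t unfolding G_def by blast
        qed
        moreover have "i < m"
          using T by (simp add: G_def Node)
        ultimately show ?thesis
          using top(1) Node by blast
      qed simp
    qed
    moreover have "finite (insert Leaf (\<Union>i<m. ?B i))"
      using less.IH by (auto intro!: finite_lists_length_eq)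
    ultimately show ?case by (rule finite_subset)
  qed
  have "{T. decreasing_tree n s T} \<subseteq> G (Suc n)"
    by (auto simp: decreasing_tree_def G_def)
  then show ?thesis using fin by (rule finite_subset)
qed

section \<open>Order complexes and spheres\<close>

text \<open>Simplices are the nonempty finite chains; the empty face is not recorded.\<close>

definition order_complex :: "'a set \<Rightarrow> ('a \<Rightarrow> 'a \<Rightarrow> bool) \<Rightarrow> 'a set set" where
  "order_complex P le =
     {C. C \<subseteq> P \<and> finite C \<and> C \<noteq> {} \<and> Complete_Partial_Order.chain le C}"

text \<open>
  Barycentric coordinates, indexed by the vertex set \<open>\<Union>K\<close>. The topology is that of pointwise
  convergence, which is the usual one because only finite complexes occur (see
  \<open>finite_decreasing_trees\<close>). The realization of the complex without vertices is empty.
\<close>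

definition geometric_realization :: "'a set set \<Rightarrow> ('a \<Rightarrow> real) topology" where
  "geometric_realization K =
     subtopology (powertop_real (\<Union>K))
       {x. (\<forall>v\<in>\<Union>K. 0 \<le> x v) \<and> {v \<in> \<Union>K. x v \<noteq> 0} \<in> K \<and>
           (\<Sum>v | v \<in> \<Union>K \<and> x v \<noteq> 0. x v) = 1}"

definition interval_complex :: "nat \<Rightarrow> (nat \<Rightarrow> nat) \<Rightarrow> ltree \<Rightarrow> ltree \<Rightarrow> (ltree \<Rightarrow> real) topology" where
  "interval_complex n s T Z =
     geometric_realization (order_complex (open_interval n s T Z) (weak_le n s))"

text \<open>
  Spheres have dimension at least \<open>-1\<close>, the sphere of dimension \<open>-1\<close> being the empty space. This
  is the case of a cover relation, whose open interval is empty.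
\<close>

definition sphere_space :: "int \<Rightarrow> (nat \<Rightarrow> real) topology" where
  "sphere_space d = (if d < 0 then trivial_topology else nsphere (nat d))"

definition homotopy_sphere :: "'a topology \<Rightarrow> int \<Rightarrow> bool" where
  "homotopy_sphere X d \<longleftrightarrow> d \<ge> -1 \<and> X homotopy_equivalent_space sphere_space d"

end

theory Submission
  imports Defs "HOL-Homology.Brouwer_Degree"
begin

text \<open>
  Decreasing trees are encoded by their inversion functions \<open>I y x\<close>: these are the bounded,
  transitive and planar functions, and the transitive closure of a union of such functions is again
  planar, so it is the join. Every element of the interval other than \<open>T\<close> lies above one of the
  rotations \<open>T\<^sub>1, \<dots>, T\<^sub>l\<close> of \<open>T\<close> along \<open>(a\<^sub>i, b\<^sub>i)\<close>, and \<open>T\<^sub>i\<close> lies below the join of a set of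
  rotations only if it belongs to that set. Moreover the sets \<open>A\<^sub>T(a\<^sub>i, b\<^sub>i)\<close> are disjoint, so the right-hand
  side of the criterion is the inversion set of the join \<open>J\<close> of all rotations.

  Sending \<open>W\<close> to the join \<open>f W \<le> W\<close> of the rotations below \<open>W\<close> is homotopic to the identity. If \<open>J \<noteq> Z\<close>,
  then also \<open>f W \<le> J\<close> and the order complex is contractible. If \<open>J = Z\<close>, then the image of \<open>f\<close> is
  the proper part of the Boolean lattice on \<open>l\<close> atoms, whose order complex is the barycentric
  subdivision of the boundary of a simplex, a sphere of dimension \<open>l - 2\<close>.
\<close>

section \<open>Tree inversion functions\<close>

text \<open>The conditions on an inversion function compare values at two or three labels only, so
  rotations and joins are built value by value and no subtree is cut and pasted.

  Transitivity is kept apart from planarity because closures ask for leastness among all transitive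
  sets. A join is the closure under transitivity alone, and planarity is inherited. Hence an upper
  bound that shows an atom not to lie below a join may be any transitive function, planar or not,
  and can be chosen as large as possible wherever this does no harm.

  The delicate configuration is that of several ascents with the same \<open>b\<close> in the same
  child of \<open>b\<close>. There the larger label has \<open>s a = 0\<close>, so zero entries of
  the composition shape the proofs of disjointness and independence.

  On the topological side one picture serves twice: the masses of a point are stacked along its
  chain and cut at a threshold. Cutting at height \<open>t\<close> gives the homotopy between
  comparable maps; reading off the set present at each height recovers a point from its image in the
  sphere.\<close>

text \<open>An inversion function comes from a decreasing tree exactly if it is bounded by \<open>s\<close>, transitive
  and planar; planarity is the third condition.\<close>

definition is_tree_inv :: "nat set \<Rightarrow> (nat \<Rightarrow> nat) \<Rightarrow> (nat \<Rightarrow> nat \<Rightarrow> nat) \<Rightarrow> bool" where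
  "is_tree_inv A s I \<longleftrightarrow>
     (\<forall>y\<in>A. \<forall>x\<in>A. x < y \<longrightarrow> I y x \<le> s y) \<and>
     (\<forall>a\<in>A. \<forall>b\<in>A. \<forall>c\<in>A. a < b \<and> b < c \<longrightarrow> I b a = 0 \<or> I c b \<le> I c a) \<and>
     (\<forall>a\<in>A. \<forall>b\<in>A. \<forall>c\<in>A. a < b \<and> b < c \<longrightarrow> I b a = s b \<or> I c a \<le> I c b)"

text \<open>Separate from \<open>is_tree_inv\<close> because the functions against which joins and
  closures are tested are transitive but not always planar.\<close>

definition inv_trans :: "nat set \<Rightarrow> (nat \<Rightarrow> nat \<Rightarrow> nat) \<Rightarrow> bool" where
  "inv_trans A I \<longleftrightarrow>
     (\<forall>a\<in>A. \<forall>b\<in>A. \<forall>c\<in>A. a < b \<and> b < c \<longrightarrow> I b a = 0 \<or> I c b \<le> I c a)"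

definition inv_le :: "nat set \<Rightarrow> (nat \<Rightarrow> nat \<Rightarrow> nat) \<Rightarrow> (nat \<Rightarrow> nat \<Rightarrow> nat) \<Rightarrow> bool" where
  "inv_le A I J \<longleftrightarrow> (\<forall>y\<in>A. \<forall>x\<in>A. x < y \<longrightarrow> I y x \<le> J y x)"

lemma is_tree_invI:
  assumes "\<And>x y. x \<in> A \<Longrightarrow> y \<in> A \<Longrightarrow> x < y \<Longrightarrow> I y x \<le> s y"
    and "\<And>a b c. a \<in> A \<Longrightarrow> b \<in> A \<Longrightarrow> c \<in> A \<Longrightarrow> a < b \<Longrightarrow> b < c \<Longrightarrow> 0 < I b a \<Longrightarrow> I c b \<le> I c a"
    and "\<And>a b c. a \<in> A \<Longrightarrow> b \<in> A \<Longrightarrow> c \<in> A \<Longrightarrow> a < b \<Longrightarrow> b < c \<Longrightarrow> I b a < s b \<Longrightarrow> I c a \<le> I c b"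
  shows "is_tree_inv A s I"
  unfolding is_tree_inv_def using assms by (meson le_neq_implies_less neq0_conv)

lemma is_tree_inv_bound: "is_tree_inv A s I \<Longrightarrow> x \<in> A \<Longrightarrow> y \<in> A \<Longrightarrow> x < y \<Longrightarrow> I y x \<le> s y"
  by (simp add: is_tree_inv_def)

lemma is_tree_inv_trans:
  "is_tree_inv A s I \<Longrightarrow> a \<in> A \<Longrightarrow> b \<in> A \<Longrightarrow> c \<in> A \<Longrightarrow> a < b \<Longrightarrow> b < c \<Longrightarrow> 0 < I b a \<Longrightarrow> I c b \<le> I c a"
  unfolding is_tree_inv_def by (metis less_numeral_extra(3))

lemma is_tree_inv_planar:
  "is_tree_inv A s I \<Longrightarrow> a \<in> A \<Longrightarrow> b \<in> A \<Longrightarrow> c \<in> A \<Longrightarrow> a < b \<Longrightarrow> b < c \<Longrightarrow> I b a \<noteq> s b \<Longrightarrow> I c a \<le> I c b"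
  unfolding is_tree_inv_def by blast

lemma is_tree_inv_imp_inv_trans: "is_tree_inv A s I \<Longrightarrow> inv_trans A I"
  by (simp add: is_tree_inv_def inv_trans_def)

lemma inv_transD:
  "inv_trans A I \<Longrightarrow> a \<in> A \<Longrightarrow> b \<in> A \<Longrightarrow> c \<in> A \<Longrightarrow> a < b \<Longrightarrow> b < c \<Longrightarrow> 0 < I b a \<Longrightarrow> I c b \<le> I c a"
  unfolding inv_trans_def by (metis less_numeral_extra(3))

section \<open>Joins of tree inversion functions\<close>

text \<open>A derivation is a descending sequence of labels from \<open>c\<close> to
  \<open>a\<close>: its first inversion has multiplicity at least \<open>k\<close>, all later ones
  are positive, and each may come from a different member of \<open>F\<close>. Such a sequence
  forces multiplicity \<open>k\<close> at \<open>(c, a)\<close> in every transitive upper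
  bound.\<close>

inductive inv_path :: "nat set \<Rightarrow> (nat \<Rightarrow> nat \<Rightarrow> nat) set \<Rightarrow> nat \<Rightarrow> nat \<Rightarrow> nat \<Rightarrow> bool"
  for A F where
  base: "I \<in> F \<Longrightarrow> a \<in> A \<Longrightarrow> c \<in> A \<Longrightarrow> a < c \<Longrightarrow> k \<le> I c a \<Longrightarrow> inv_path A F c a k"
| step: "inv_path A F c b k \<Longrightarrow> I \<in> F \<Longrightarrow> a \<in> A \<Longrightarrow> a < b \<Longrightarrow> 0 < I b a \<Longrightarrow> inv_path A F c a k"

text \<open>The alternative \<open>k = 0\<close> and the bound \<open>s c\<close> make the set
  nonempty and finite, so that \<open>Max\<close> is meaningful.\<close>

definition inv_join :: "nat set \<Rightarrow> (nat \<Rightarrow> nat) \<Rightarrow> (nat \<Rightarrow> nat \<Rightarrow> nat) set \<Rightarrow> nat \<Rightarrow> nat \<Rightarrow> nat" where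
  "inv_join A s F c a = Max {k. k \<le> s c \<and> (k = 0 \<or> inv_path A F c a k)}"

lemma inv_path_mem: "inv_path A F c a k \<Longrightarrow> a \<in> A \<and> c \<in> A \<and> a < c"
  by (induction rule: inv_path.induct) auto

text \<open>Concatenation of paths. The first inversion of the lower path is positive because
  \<open>0 < j\<close>, so it can serve as a \<open>step\<close> after the upper path.\<close>

lemma inv_path_trans:
  assumes "inv_path A F b a j" "0 < j" "inv_path A F c b k"
  shows "inv_path A F c a k"
  using assms
proof (induction rule: inv_path.induct)
  case (base I a b j)
  then show ?case by (meson inv_path.step less_le_trans)
next
  case (step b d j I a)
  then show ?case by (meson inv_path.step)
qed

text \<open>Every \<open>step\<close> of the path is one application of the transitivity of
  \<open>K\<close>.\<close>

lemma inv_path_le: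
  assumes "inv_path A F c a k" "inv_trans A K" "\<And>I. I \<in> F \<Longrightarrow> inv_le A I K"
  shows "k \<le> K c a"
  using assms
proof (induction rule: inv_path.induct)
  case (base I a c k)
  then show ?case unfolding inv_le_def by (meson le_trans)
next
  case (step c b k I a)
  have "b \<in> A" "c \<in> A" "b < c" using inv_path_mem[OF step.hyps(1)] by auto
  moreover have "0 < K b a"
    using step.prems(2)[OF step.hyps(2)] step.hyps \<open>b \<in> A\<close> unfolding inv_le_def
    by (meson less_le_trans)
  ultimately show ?case
    using step.IH[OF step.prems] inv_transD[OF step.prems(1), of a b c] step.hyps by linarith
qed

text \<open>Why planarity survives the closure: \<open>b\<close> is met by the path or jumped over
  by one of its inversions. In the latter case planarity of the function used there either gives the
  full value \<open>s b\<close> at the lower end, or lets that inversion be redirected to end at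
  \<open>b\<close>. Later steps merely prolong a path of the first kind.\<close>

lemma inv_path_planar:
  assumes "inv_path A F c a k" and F: "\<And>I. I \<in> F \<Longrightarrow> is_tree_inv A s I"
    and "b \<in> A" "a < b" "b < c" "0 < k"
  shows "s b = 0 \<or> inv_path A F b a (s b) \<or> inv_path A F c b k"
  using assms(1,3-)
proof (induction rule: inv_path.induct)
  case (base I a c k)
  show ?case
  proof (cases "I b a = s b")
    case True
    then show ?thesis using base inv_path.base[of I F a A b "s b"] by auto
  next
    case False
    then have "I c a \<le> I c b"
      using is_tree_inv_planar[OF F] base by blast
    then show ?thesis using base inv_path.base[of I F b A c k] by auto
  qed
next
  case (step c d k I a)
  have d: "d \<in> A" "c \<in> A" "d < c" using inv_path_mem[OF step.hyps(1)] by auto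
  consider "b = d" | "d < b" | "b < d" by linarith
  then show ?case
  proof cases
    case 1
    then show ?thesis using step.hyps by simp
  next
    case 2
    then show ?thesis using step inv_path.step by blast
  next
    case 3
    show ?thesis
    proof (cases "I b a = s b")
      case True
      then show ?thesis using step inv_path.base[of I F a A b "s b"] by auto
    next
      case False
      then have "I d a \<le> I d b"
        using is_tree_inv_planar[OF F] step d 3 by blast
      then show ?thesis
        using inv_path.step[OF step.hyps(1), of I b] step 3 by auto
    qed
  qed
qed

text \<open>Path multiplicities are closed downwards and never exceed the first inversion, hence
  \<open>s c\<close>. The restriction to positive \<open>k\<close> matters: the join may be 0 at a
  pair that no path connects.\<close>

lemma inv_path_join_iff:
  assumes F: "\<And>I. I \<in> F \<Longrightarrow> is_tree_inv A s I" and "0 < k"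
  shows "inv_path A F c a k \<longleftrightarrow> a \<in> A \<and> c \<in> A \<and> a < c \<and> k \<le> inv_join A s F c a"
proof -
  have bound: "inv_path A F c a j \<Longrightarrow> j \<le> s c" for c a j
    by (induction rule: inv_path.induct) (meson F is_tree_inv_bound le_trans | assumption)+
  have down: "inv_path A F c a j \<Longrightarrow> i \<le> j \<Longrightarrow> inv_path A F c a i" for c a i j
    by (induction rule: inv_path.induct) (meson inv_path.intros le_trans)+
  define M where "M = {k. k \<le> s c \<and> (k = 0 \<or> inv_path A F c a k)}"
  have M: "finite M" "0 \<in> M" by (auto simp: M_def)
  then have "Max M \<in> M" by (metis Max_in empty_iff)
  have join: "inv_join A s F c a = Max M" by (simp add: inv_join_def M_def)
  show ?thesis
  proof
    assume p: "inv_path A F c a k"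
    then have "k \<in> M" using bound by (simp add: M_def)
    then show "a \<in> A \<and> c \<in> A \<and> a < c \<and> k \<le> inv_join A s F c a"
      using Max_ge[OF M(1)] inv_path_mem[OF p] join by simp
  next
    assume "a \<in> A \<and> c \<in> A \<and> a < c \<and> k \<le> inv_join A s F c a"
    then have "k \<le> Max M" using join by simp
    moreover have "inv_path A F c a (Max M)"
    proof -
      have "Max M = 0 \<or> inv_path A F c a (Max M)"
        using \<open>Max M \<in> M\<close> by (subst (asm) (2) M_def) simp
      then show ?thesis using \<open>0 < k\<close> \<open>k \<le> Max M\<close> by auto
    qed
    ultimately show "inv_path A F c a k" using down by blast
  qed
qed

text \<open>Leastness holds against every transitive \<open>K\<close>. This generality identifies
  joins with closures and admits the separating functions of
  \<open>inv_ascent_independent\<close>.\<close>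

lemma inv_join_le:
  assumes "inv_trans A K" "\<And>I. I \<in> F \<Longrightarrow> inv_le A I K"
    "\<And>I. I \<in> F \<Longrightarrow> is_tree_inv A s I"
  shows "inv_le A (inv_join A s F) K"
  unfolding inv_le_def
proof (intro ballI impI)
  fix y x assume "y \<in> A" "x \<in> A" "x < y"
  then show "inv_join A s F y x \<le> K y x"
    using inv_path_le[OF _ assms(1,2), of F y x "inv_join A s F y x"]
      inv_path_join_iff[OF assms(3), of F "inv_join A s F y x" y x]
    by (cases "inv_join A s F y x = 0") auto
qed

lemma inv_join_upper:
  assumes "\<And>I. I \<in> F \<Longrightarrow> is_tree_inv A s I" "I \<in> F"
  shows "inv_le A I (inv_join A s F)"
  unfolding inv_le_def
proof (intro ballI impI)
  fix y x assume *: "y \<in> A" "x \<in> A" "x < y"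
  then have "inv_path A F y x (I y x)" using assms by (auto intro: inv_path.base)
  then show "I y x \<le> inv_join A s F y x"
    using inv_path_join_iff[OF assms(1), of F "I y x" y x] by (cases "I y x = 0") auto
qed

lemma is_tree_inv_join:
  assumes F: "\<And>I. I \<in> F \<Longrightarrow> is_tree_inv A s I"
  shows "is_tree_inv A s (inv_join A s F)"
proof (rule is_tree_invI)
  note iff = inv_path_join_iff[OF F]
  have bound: "inv_join A s F y x \<le> s y" for x y
  proof -
    define M where "M = {k. k \<le> s y \<and> (k = 0 \<or> inv_path A F y x k)}"
    have "finite M" "0 \<in> M" by (auto simp: M_def)
    then have "Max M \<in> M" by (metis Max_in empty_iff)
    then show ?thesis by (simp add: inv_join_def M_def)
  qed
  then show "inv_join A s F y x \<le> s y" for x y .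
  show "inv_join A s F c b \<le> inv_join A s F c a"
    if "a \<in> A" "b \<in> A" "c \<in> A" "a < b" "b < c" "0 < inv_join A s F b a" for a b c
    using iff[of F "inv_join A s F b a" b a] iff[of F "inv_join A s F c b" c b]
      iff[of F "inv_join A s F c b" c a] that
      inv_path_trans[of A F b a "inv_join A s F b a" c "inv_join A s F c b"]
    by (cases "inv_join A s F c b = 0") auto
  show "inv_join A s F c a \<le> inv_join A s F c b"
    if "a \<in> A" "b \<in> A" "c \<in> A" "a < b" "b < c" "inv_join A s F b a < s b" for a b c
  proof (cases "inv_join A s F c a = 0")
    case False
    then have "inv_path A F c a (inv_join A s F c a)"
      using iff[of F "inv_join A s F c a" c a] that by auto
    from inv_path_planar[OF this F, of b] False that
    have "inv_path A F b a (s b) \<or> inv_path A F c b (inv_join A s F c a)" by auto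
    then show ?thesis
      using iff[of F "s b" b a] iff[of F "inv_join A s F c a" c b] that False by auto
  qed simp
qed

section \<open>Ascents and rotations\<close>

text \<open>Ancestry read off the values: \<open>a\<close> lies below \<open>b\<close> if every
  larger label sees both in the same place. For trees this is justified by
  \<open>mem_child_iff\<close>.\<close>

definition inv_desc :: "nat set \<Rightarrow> (nat \<Rightarrow> nat \<Rightarrow> nat) \<Rightarrow> nat \<Rightarrow> nat \<Rightarrow> bool" where
  "inv_desc A I b a \<longleftrightarrow> a \<in> A \<and> b \<in> A \<and> a < b \<and> (\<forall>c\<in>A. b < c \<longrightarrow> I c a = I c b)"

definition inv_ascent :: "nat set \<Rightarrow> (nat \<Rightarrow> nat) \<Rightarrow> (nat \<Rightarrow> nat \<Rightarrow> nat) \<Rightarrow> nat \<Rightarrow> nat \<Rightarrow> bool" where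
  "inv_ascent A s I a b \<longleftrightarrow> inv_desc A I b a \<and> I b a < s b \<and>
     (\<forall>e. e < b \<and> inv_desc A I e a \<longrightarrow> I e a = s e) \<and>
     (0 < s a \<longrightarrow> (\<forall>x. inv_desc A I a x \<longrightarrow> I a x \<noteq> s a))"

text \<open>Besides \<open>a\<close>, the labels of the subtrees \<open>T\<^sup>a\<^sub>k\<close> with \<open>k > 0\<close> move to the next child of \<open>b\<close>.\<close>

definition inv_rotate :: "(nat \<Rightarrow> nat \<Rightarrow> nat) \<Rightarrow> nat \<Rightarrow> nat \<Rightarrow> nat \<Rightarrow> nat \<Rightarrow> nat" where
  "inv_rotate I a b y x =
     (if y = b \<and> I b x = I b a \<and> (x = a \<or> x < a \<and> 0 < I a x) then I y x + 1 else I y x)"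

text \<open>Extends the ascent condition from ancestors of \<open>a\<close> to all intermediate
  labels. If \<open>y\<close> is no ancestor, some larger \<open>c\<close> separates it from
  \<open>a\<close>, and planarity puts \<open>y\<close> to the right as seen from \<open>c\<close>
  unless \<open>I y a = s y\<close>. For \<open>c \<ge> b\<close> this decides the place of
  \<open>y\<close> relative to \<open>b\<close>; for \<open>c < b\<close> the induction applies to
  \<open>c\<close>, which is closer to \<open>b\<close>.\<close>

lemma inv_ascent_between:
  assumes I: "is_tree_inv A s I" and asc: "inv_ascent A s I a b"
    and "y \<in> A" "a < y" "y < b"
  shows "I y a = s y \<or> I b a < I b y"
  using assms(3-)
proof (induction "b - y" arbitrary: y rule: less_induct)
  case less
  have ab: "a \<in> A" "b \<in> A" "a < b" "\<And>c. c \<in> A \<Longrightarrow> b < c \<Longrightarrow> I c a = I c b" "I b a < s b"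
    using asc by (auto simp: inv_ascent_def inv_desc_def)
  note pl = is_tree_inv_planar[OF I]
  show ?case
  proof (cases "inv_desc A I y a")
    case True
    then show ?thesis using asc less.prems by (auto simp: inv_ascent_def)
  next
    case False
    then obtain c where c: "c \<in> A" "y < c" "I c a \<noteq> I c y"
      using less.prems ab by (auto simp: inv_desc_def)
    show ?thesis
    proof (cases "I y a = s y")
      case False
      then have *: "I c a < I c y"
        using pl[of a y c] c less.prems ab by auto
      consider "c = b" | "b < c" | "c < b" by linarith
      then show ?thesis
      proof cases
        case 1
        then show ?thesis using * by simp
      next
        case 2
        then show ?thesis
          using * ab pl[of y b c] c less.prems by fastforce
      next
        case 3
        have "I c a = s c \<or> I b a < I b c"
          using less.hyps[of c] c 3 less.prems by auto
        moreover have "I c y \<le> s c" using is_tree_inv_bound[OF I] c less.prems by auto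
        ultimately show ?thesis
          using is_tree_inv_trans[OF I, of y c b] * c less.prems ab 3 by auto
      qed
    qed simp
  qed
qed

text \<open>Only values at \<open>(b, x)\<close> with \<open>M x\<close> change, so each triple
  condition has to be rechecked only where such a pair occurs. The ascent conditions enter through
  \<open>inv_ascent_between\<close>, in the planar case with \<open>a < y\<close>.\<close>

lemma is_tree_inv_rotate:
  assumes I: "is_tree_inv A s I" and asc: "inv_ascent A s I a b"
  shows "is_tree_inv A s (inv_rotate I a b)"
proof -
  have ab: "a \<in> A" "b \<in> A" "a < b" "\<And>c. c \<in> A \<Longrightarrow> b < c \<Longrightarrow> I c a = I c b" "I b a < s b"
    using asc by (auto simp: inv_ascent_def inv_desc_def)
  note bd = is_tree_inv_bound[OF I] and tr = is_tree_inv_trans[OF I]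
    and pl = is_tree_inv_planar[OF I]
  define M where "M x \<longleftrightarrow> I b x = I b a \<and> (x = a \<or> x < a \<and> 0 < I a x)" for x
  have R: "inv_rotate I a b y x = (if y = b \<and> M x then I y x + 1 else I y x)" for x y
    by (simp add: inv_rotate_def M_def)
  show ?thesis
  proof (rule is_tree_invI)
    show "inv_rotate I a b y x \<le> s y" if "x \<in> A" "y \<in> A" "x < y" for x y
      using bd[of x y] that ab by (auto simp: R M_def)
  next
    fix x y z assume A: "x \<in> A" "y \<in> A" "z \<in> A" and xyz: "x < y" "y < z"
      and pos: "0 < inv_rotate I a b y x"
    \<comment> \<open>In the first case the premise may have become true only by the rotation. In
      the second the left-hand side was raised, so \<open>x\<close> has to be moved along with
      \<open>y\<close> unless its value was larger already.\<close>
    consider "y = b" "M x" "z \<noteq> b" | "z = b" "M y" "y \<noteq> b" | "\<not> (y = b \<and> M x)" "\<not> (z = b \<and> M y)"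
      using xyz by auto
    then show "inv_rotate I a b z y \<le> inv_rotate I a b z x"
    proof cases
      case 1
      have "I z b \<le> I z x"
      proof (cases "x = a")
        case False
        then have "I z a \<le> I z x" using tr[of x a z] 1 A xyz ab by (auto simp: M_def)
        then show ?thesis using ab(4)[of z] A xyz 1 by simp
      qed (use ab xyz 1 A in auto)
      then show ?thesis using 1 by (simp add: R)
    next
      case 2
      have p: "0 < I y x" using pos 2 by (simp add: R)
      then have "I b y \<le> I b x" using tr[of x y b] A xyz 2 by auto
      moreover have "M x" if "I b x = I b y"
        using tr[of x y a] that p 2 A xyz ab by (cases "y = a") (auto simp: M_def)
      ultimately show ?thesis using 2 by (cases "I b x = I b y") (auto simp: R)
    next
      case 3
      then show ?thesis using tr[of x y z] pos A xyz by (auto simp: R)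
    qed
  next
    fix x y z assume A: "x \<in> A" "y \<in> A" "z \<in> A" and xyz: "x < y" "y < z"
      and lt: "inv_rotate I a b y x < s y"
    have lt': "I y x < s y" using lt by (auto simp: R split: if_splits)
    then have le: "I z x \<le> I z y" using pl[of x y z] A xyz by auto
    show "inv_rotate I a b z x \<le> inv_rotate I a b z y"
    proof (cases "z = b \<and> M x")
      case True
      then have z: "z = b" "M x" by auto
      \<comment> \<open>The value at \<open>(b, x)\<close> was raised, so \<open>y\<close> must have
        been strictly further right than \<open>a\<close> or be moved too.\<close>
      consider "y = a" | "a < y" | "y < a" by linarith
      then have "I b a < I b y \<or> M y"
      proof cases
        case 1
        then show ?thesis by (simp add: M_def)
      next
        case 2
        have "I y a \<noteq> s y"
          using tr[of x a y] z lt' A ab 2 by (auto simp: M_def)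
        then show ?thesis
          using inv_ascent_between[OF I asc, of y] A 2 xyz z by auto
      next
        case 3
        then have "I a x \<le> I a y" using pl[of x y a] lt' A xyz ab by auto
        then show ?thesis using z le 3 xyz by (auto simp: M_def)
      qed
      then show ?thesis using z le by (auto simp: R M_def)
    next
      case False
      then show ?thesis using le by (auto simp: R)
    qed
  qed
qed

lemma inv_rotate_ge: "inv_le A I (inv_rotate I a b)"
  by (simp add: inv_le_def inv_rotate_def)

text \<open>All other changes are forced by the one at \<open>(b, a)\<close>: a moved label
  \<open>x < a\<close> satisfies \<open>0 < K a x\<close>, so transitivity passes the raised value
  from \<open>a\<close> on to \<open>x\<close>.\<close>

lemma inv_rotate_least:
  assumes K: "inv_trans A K" and "inv_le A I K" and "a \<in> A" "b \<in> A" "a < b" "I b a < K b a"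
  shows "inv_le A (inv_rotate I a b) K"
proof -
  have "I b x < K b x" if "x \<in> A" "x < a" "0 < I a x" "I b x = I b a" for x
  proof -
    have "0 < K a x" using assms that unfolding inv_le_def by (meson less_le_trans)
    then show ?thesis using inv_transD[OF K, of x a b] assms that by auto
  qed
  then show ?thesis
    using assms unfolding inv_le_def inv_rotate_def by (auto simp: Suc_le_eq)
qed

text \<open>Take \<open>b\<close> minimal and then, among the descendants \<open>a\<close> of \<open>b\<close> on which \<open>I\<close> and \<open>J\<close> differ
  and which satisfy the condition on the intermediate labels, \<open>a\<close> minimal.\<close>

lemma ex_inv_ascent:
  assumes I: "is_tree_inv A s I" and J: "is_tree_inv A s J" and "finite A"
    and le: "inv_le A I J" and "\<not> inv_le A J I"
  shows "\<exists>a b. inv_ascent A s I a b \<and> I b a < J b a"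
proof -
  note bdI = is_tree_inv_bound[OF I] and trI = is_tree_inv_trans[OF I]
    and plI = is_tree_inv_planar[OF I]
  note bdJ = is_tree_inv_bound[OF J] and trJ = is_tree_inv_trans[OF J]
    and plJ = is_tree_inv_planar[OF J]
  have leD: "x \<in> A \<Longrightarrow> y \<in> A \<Longrightarrow> x < y \<Longrightarrow> I y x \<le> J y x" for x y
    using le by (auto simp: inv_le_def)
  have desc_trans: "inv_desc A I c a" if "inv_desc A I c b" "inv_desc A I b a" for a b c
    using that by (auto simp: inv_desc_def)
  have desc_comp: "inv_desc A I c b" if "inv_desc A I c a" "inv_desc A I b a" "b < c" for a b c
    using that by (auto simp: inv_desc_def)
  define D where "D b a \<longleftrightarrow> inv_desc A I b a \<and> I b a < J b a" for a b
  have "\<exists>b a. D b a"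
  proof -
    obtain a b0 where a: "a \<in> A" and b0: "b0 \<in> A" "a < b0" "I b0 a < J b0 a"
      using \<open>\<not> inv_le A J I\<close> unfolding inv_le_def by (auto simp: not_le)
    \<comment> \<open>For the largest \<open>b\<close> at which the functions differ on
      \<open>(b, a)\<close>, \<open>b\<close> is an ancestor of \<open>a\<close>: a separating
      \<open>c > b\<close> would give a difference at \<open>(c, a)\<close>, by planarity of
      \<open>I\<close> and transitivity of \<open>J\<close>.\<close>
    define B where "B = {b \<in> A. a < b \<and> I b a < J b a}"
    define b where "b = Max B"
    have B: "finite B" "b0 \<in> B" using \<open>finite A\<close> b0 by (auto simp: B_def)
    then have b: "b \<in> B" "\<And>c. c \<in> B \<Longrightarrow> c \<le> b"
      unfolding b_def using Max_in Max_ge by auto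
    have "I c a = I c b" if c: "c \<in> A" "b < c" for c
    proof (rule ccontr)
      assume neq: "I c a \<noteq> I c b"
      have "I b a \<noteq> s b" using b bdJ[of a b] a by (auto simp: B_def)
      then have "I c a < I c b" using plI[of a b c] neq c a b by (auto simp: B_def)
      also have "\<dots> \<le> J c b" using leD c b by (auto simp: B_def)
      also have "\<dots> \<le> J c a" using trJ[of a b c] c a b by (auto simp: B_def)
      finally have "c \<in> B" using c a b by (auto simp: B_def)
      then show False using b(2) c by fastforce
    qed
    then show ?thesis using a b unfolding D_def inv_desc_def B_def by blast
  qed
  define b where "b = (LEAST b. \<exists>a. D b a)"
  have Db: "\<exists>a. D b a" and bmin: "D b' a \<Longrightarrow> b \<le> b'" for b' a
    unfolding b_def using LeastI_ex[OF \<open>\<exists>b a. D b a\<close>] by (auto intro: Least_le)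
  define G where "G a \<longleftrightarrow> D b a \<and> (\<forall>e. e < b \<and> inv_desc A I e a \<longrightarrow> I e a = s e)" for a
  \<comment> \<open>If the intermediate condition fails at \<open>e\<close>, the difference moves
    from \<open>a\<close> up to \<open>e\<close>: minimality of \<open>b\<close> gives
    \<open>I e a = J e a\<close>, and planarity of \<open>J\<close> applies. So the largest
    \<open>a\<close> with \<open>D b a\<close> satisfies \<open>G\<close>.\<close>
  have up: "D b e" if "D b a" "e < b" "inv_desc A I e a" "I e a \<noteq> s e" for a e
  proof -
    have "\<not> D e a" using bmin[of e a] that by auto
    then have "\<not> I e a < J e a" using that(3) by (simp add: D_def)
    then have "I e a = J e a"
      using that(3) leD[of a e] by (simp add: inv_desc_def)
    then have "J b a \<le> J b e"
      using plJ[of a e b] that by (auto simp: D_def inv_desc_def)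
    moreover have "I b a = I b e" using that by (auto simp: D_def inv_desc_def)
    moreover have "inv_desc A I b e" using desc_comp[of b a e] that by (auto simp: D_def)
    ultimately show ?thesis using that by (auto simp: D_def)
  qed
  have fin: "finite {a. D b a}"
    by (rule finite_subset[OF _ \<open>finite A\<close>]) (auto simp: D_def inv_desc_def)
  have "\<exists>a. G a"
  proof -
    define a where "a = Max {a. D b a}"
    have "D b a" "\<And>x. D b x \<Longrightarrow> x \<le> a" using Max_in[OF fin] Max_ge[OF fin] Db by (auto simp: a_def)
    moreover then have "I e a = s e" if "e < b" "inv_desc A I e a" for e
      using up[of a e] that unfolding inv_desc_def by fastforce
    ultimately show ?thesis by (auto simp: G_def)
  qed
  define a where "a = (LEAST a. G a)"
  have Ga: "G a" and amin: "G a' \<Longrightarrow> a \<le> a'" for a'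
    unfolding a_def using LeastI_ex[OF \<open>\<exists>a. G a\<close>] by (auto intro: Least_le)
  have Dba: "inv_desc A I b a" "I b a < J b a" using Ga by (auto simp: G_def D_def)
  have False if "0 < s a" and x: "inv_desc A I a x0" "I a x0 = s a" for x0
  proof -
    \<comment> \<open>\<open>X\<close> is the label set of the last subtree of \<open>a\<close> and
      \<open>x\<close> its root. It is shown to satisfy \<open>G\<close> again, against the
      minimality of \<open>a\<close>.\<close>
    define X where "X = {x. inv_desc A I a x \<and> I a x = s a}"
    define x where "x = Max X"
    have "finite X" by (rule finite_subset[OF _ \<open>finite A\<close>]) (auto simp: X_def inv_desc_def)
    then have x: "x \<in> X" "\<And>z. z \<in> X \<Longrightarrow> z \<le> x" using Max_in[of X] Max_ge x by (auto simp: x_def X_def)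
    then have xa: "inv_desc A I a x" "I a x = s a" by (auto simp: X_def)
    then have mem: "x \<in> A" "a \<in> A" "b \<in> A" "x < a" "a < b" using Dba by (auto simp: inv_desc_def)
    have "I b x = I b a" using xa mem by (auto simp: inv_desc_def)
    moreover have "0 < J a x" using leD[of x a] mem xa \<open>0 < s a\<close> by auto
    then have "J b a \<le> J b x" using trJ[of x a b] mem by auto
    ultimately have Dx: "D b x" using Dba desc_trans[OF Dba(1) xa(1)] by (auto simp: D_def)
    have "I e x = s e" if e: "e < b" "inv_desc A I e x" for e
    proof (rule ccontr)
      assume neq: "I e x \<noteq> s e"
      consider "e < a" | "e = a" | "a < e" by linarith
      then show False
      proof cases
        case 1
        then have "inv_desc A I a e" using desc_comp[OF xa(1) e(2)] by simp
        moreover have "I a e = s a" using xa e 1 mem by (auto simp: inv_desc_def)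
        ultimately have "e \<in> X" by (simp add: X_def)
        then show False using x(2)[of e] e by (auto simp: inv_desc_def)
      next
        case 2
        then show False using neq xa by simp
      next
        case 3
        then have "inv_desc A I e a" using desc_comp[OF e(2) xa(1)] by simp
        moreover have "I e a = I e x" using xa e 3 by (auto simp: inv_desc_def)
        ultimately show False using Ga e neq by (auto simp: G_def)
      qed
    qed
    then have "G x" using Dx by (auto simp: G_def)
    then show False using amin mem by fastforce
  qed
  then have "inv_ascent A s I a b"
    unfolding inv_ascent_def using Ga Dba bdJ[of a b] by (fastforce simp: G_def inv_desc_def)
  then show ?thesis using Dba by blast
qed

text \<open>Every label above \<open>a\<close> sees \<open>a\<close> and \<open>a'\<close> in the
  same place, so \<open>a'\<close> is a descendant of \<open>a\<close>, and it lies in the last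
  subtree by \<open>inv_ascent_between\<close>. The leaf condition at \<open>a\<close> allows this
  only for \<open>s a = 0\<close>.\<close>

lemma inv_ascent_same_branch:
  assumes I: "is_tree_inv A s I" and "inv_ascent A s I a b" "inv_ascent A s I a' b"
    and "I b a = I b a'" "a' < a"
  shows "s a = 0"
proof (rule ccontr)
  assume "s a \<noteq> 0"
  have m: "a \<in> A" "b \<in> A" "a' \<in> A" "a < b" "\<And>c. c \<in> A \<Longrightarrow> b < c \<Longrightarrow> I c a = I c a'"
    using assms by (auto simp: inv_ascent_def inv_desc_def)
  have "I c a' = I c a" if c: "c \<in> A" "a < c" for c
  proof -
    consider "b < c" | "c = b" | "c < b" by linarith
    then show ?thesis
    proof cases
      case 3
      show ?thesis
      proof (cases "I b a < I b c")
        case True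
        then show ?thesis
          using is_tree_inv_trans[OF I, of a c b] is_tree_inv_trans[OF I, of a' c b] assms m c 3
          by fastforce
      next
        case False
        then show ?thesis
          using inv_ascent_between[OF I assms(2), of c] inv_ascent_between[OF I assms(3), of c] c 3
            assms(4,5) by auto
      qed
    qed (use m c assms in auto)
  qed
  then have "inv_desc A I a a'" using m assms by (auto simp: inv_desc_def)
  moreover have "I a a' = s a"
    using inv_ascent_between[OF I assms(3), of a] m assms by auto
  ultimately show False using assms(2) \<open>s a \<noteq> 0\<close> by (auto simp: inv_ascent_def)
qed

text \<open>A pair raised by both rotations would put both ascents in the same child of
  \<open>b\<close>. The larger of \<open>a\<close> and \<open>a'\<close> then has
  \<open>s\<close>-value 0 and moves nothing but itself, while \<open>x\<close> is at most the
  smaller one.\<close>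

lemma inv_rotate_disjoint:
  assumes I: "is_tree_inv A s I" and "inv_ascent A s I a b" "inv_ascent A s I a' b'"
    and "(a, b) \<noteq> (a', b')" "x \<in> A" "inv_rotate I a b y x \<noteq> I y x"
  shows "inv_rotate I a' b' y x = I y x"
proof (rule ccontr)
  assume neg: "inv_rotate I a' b' y x \<noteq> I y x"
  then have b: "b = b'" "y = b" "I b x = I b a" "I b x = I b a'"
    "x = a \<or> x < a \<and> 0 < I a x" "x = a' \<or> x < a' \<and> 0 < I a' x"
    using assms(6) by (auto simp: inv_rotate_def split: if_splits)
  have m: "a \<in> A" "a' \<in> A" using assms by (auto simp: inv_ascent_def inv_desc_def)
  have "s a = 0" if "a' < a"
    using inv_ascent_same_branch[OF I assms(2), of a'] assms b that by auto
  moreover have "s a' = 0" if "a < a'"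
    using inv_ascent_same_branch[OF I assms(3), of a] assms b that by auto
  ultimately show False
    using b assms(4,5) is_tree_inv_bound[OF I, of x a] is_tree_inv_bound[OF I, of x a'] m
    by (cases a a' rule: linorder_cases) auto
qed

text \<open>The transitive set \<open>K\<close> below is built from \<open>E\<close>, which contains \<open>a\<close>: it agrees with \<open>I b a\<close> on
  \<open>(b, e)\<close> for \<open>e \<in> E\<close>, it has no inversion \<open>(f, e)\<close> with \<open>e \<in> E\<close> and \<open>f < b\<close> outside of \<open>E\<close>, and is
  maximal otherwise.\<close>

lemma inv_ascent_independent:
  assumes I: "is_tree_inv A s I" and asc: "inv_ascent A s I a b"
    and S: "\<And>a' b'. (a', b') \<in> S \<Longrightarrow> inv_ascent A s I a' b'" and notin: "(a, b) \<notin> S"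
  shows "\<exists>K. inv_trans A K \<and> inv_le A I K \<and> K b a = I b a \<and>
    (\<forall>(a', b')\<in>S. inv_le A (inv_rotate I a' b') K)"
proof -
  note bd = is_tree_inv_bound[OF I] and tr = is_tree_inv_trans[OF I]
  have ab: "a \<in> A" "b \<in> A" "a < b" "I b a < s b" using asc by (auto simp: inv_ascent_def inv_desc_def)
  \<comment> \<open>\<open>U\<close> is the pointwise maximum of \<open>I\<close> and the rotations
    in \<open>S\<close>, since a rotation raises a value by at most 1.\<close>
  define up where "up f e \<longleftrightarrow> (\<exists>(a', b')\<in>S. inv_rotate I a' b' f e \<noteq> I f e)" for f e
  define U where "U f e = (if up f e then I f e + 1 else I f e)" for f e
  have rot_U: "inv_rotate I a' b' f e \<le> U f e" if "(a', b') \<in> S" for a' b' f e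
    using that by (auto simp: U_def up_def inv_rotate_def)
  have upD: "\<exists>a'. (a', f) \<in> S \<and> inv_ascent A s I a' f \<and> I f e = I f a' \<and> (e = a' \<or> e < a' \<and> 0 < I a' e)"
    if "up f e" for f e
    using that S by (auto simp: up_def inv_rotate_def split: if_splits)
  have U_bd: "U f e \<le> s f" if "e \<in> A" "f \<in> A" "e < f" for e f
    using bd[of e f] that upD[of f e] by (auto simp: U_def inv_ascent_def)
  define E where "E = {e \<in> A. a \<le> e \<and> e < b \<and> U b e \<le> I b a}"
  define K where "K f e = (if e \<in> E \<and> f = b then I b a
    else if e \<in> E \<and> f < b \<and> f \<notin> E then 0 else s f)" for f e
  have "\<not> up b a"
  proof
    assume "up b a"
    then obtain a' b' where *: "(a', b') \<in> S" "inv_rotate I a' b' b a \<noteq> I b a"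
      by (auto simp: up_def)
    have "inv_rotate I a b b a \<noteq> I b a" by (simp add: inv_rotate_def)
    then show False
      using inv_rotate_disjoint[OF I asc S[OF *(1)], of a b] * notin ab by auto
  qed
  then have aE: "a \<in> E" using ab by (auto simp: E_def U_def)
  have Kb: "K f e \<le> s f" for f e using ab by (auto simp: K_def)
  have "inv_trans A K"
    unfolding inv_trans_def
  proof (intro ballI impI)
    \<comment> \<open>\<open>K z x\<close> is below \<open>s z\<close> only if
      \<open>x \<in> E\<close> and either \<open>z = b\<close>, or \<open>z < b\<close> and
      \<open>z \<notin> E\<close>. Then \<open>y \<in> E\<close> has the same value under
      \<open>z\<close>, and \<open>y \<notin> E\<close> gives \<open>K y x = 0\<close>.\<close>
    fix x y z assume "x \<in> A" "y \<in> A" "z \<in> A" "x < y \<and> y < z"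
    then show "K y x = 0 \<or> K z y \<le> K z x"
      using Kb[of z y] by (auto simp: K_def E_def split: if_splits)
  qed
  moreover have UK: "U f e \<le> K f e" if A: "e \<in> A" "f \<in> A" "e < f" for e f
  proof (cases "e \<in> E \<and> f < b \<and> f \<notin> E")
    case True
    then have e: "a \<le> e" "U b e \<le> I b a" and f: "f < b" "I b a < U b f"
      using A by (auto simp: E_def)
    \<comment> \<open>Either \<open>f\<close> already lies to the right of \<open>e\<close> as seen
      from \<open>b\<close>, which excludes inversions both before and after raising; or
      \<open>f\<close> is raised by another ascent in the same child of \<open>b\<close>. In the
      latter case \<open>f\<close> is that ascent's lower label and \<open>s f = 0\<close>.\<close>
    have "U f e = 0"
    proof (rule ccontr)
      assume pos: "U f e \<noteq> 0"
      have Ibe: "I b e \<le> I b a" using e by (auto simp: U_def split: if_splits)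
      show False
      proof (cases "I b a < I b f")
        case True
        then have "I f e = 0" using tr[of e f b] A f ab Ibe by fastforce
        then have "up f e" using pos by (auto simp: U_def split: if_splits)
        then obtain a' where a': "inv_ascent A s I a' f" "e = a' \<or> e < a' \<and> 0 < I a' e"
          using upD by blast
        then have *: "a' \<in> A" "a' < f" "I b a' = I b f"
          using ab f by (auto simp: inv_ascent_def inv_desc_def)
        then have "I b f \<le> I b e" using a'(2) tr[of e a' b] A f ab by auto
        then show False using True Ibe by simp
      next
        case False
        then have "up b f" using f by (auto simp: U_def split: if_splits)
        then obtain a' where a': "inv_ascent A s I a' b" "I b f = I b a'" "f = a' \<or> f < a' \<and> 0 < I a' f"
          using upD by blast
        have "I b a' = I b a" using False f a'(2) by (auto simp: U_def split: if_splits)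
        then have "s a' = 0"
          using inv_ascent_same_branch[OF I a'(1) asc] a'(3) e A by auto
        moreover have "a' \<in> A" using a' by (auto simp: inv_ascent_def inv_desc_def)
        ultimately have "f = a'" using a'(3) bd[of f a'] A by auto
        then show False using U_bd[of e f] A pos \<open>s a' = 0\<close> by auto
      qed
    qed
    then show ?thesis by simp
  next
    case False
    then show ?thesis using U_bd[OF A] by (auto simp: K_def E_def)
  qed
  moreover have "inv_le A I K"
    unfolding inv_le_def using UK by (fastforce simp: U_def split: if_splits)
  moreover have "inv_le A (inv_rotate I a' b') K" if "(a', b') \<in> S" for a' b'
    unfolding inv_le_def using UK rot_U[OF that] le_trans by blast
  moreover have "K b a = I b a" using aE by (simp add: K_def)
  ultimately show ?thesis by blast
qed

section \<open>Inversion functions of decreasing trees\<close>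

text \<open>A decreasing tree on an arbitrary label set, a notion that passes to subtrees and thus
  supports induction.\<close>

definition ordered_tree :: "(nat \<Rightarrow> nat) \<Rightarrow> ltree \<Rightarrow> bool" where
  "ordered_tree s T \<longleftrightarrow> distinct (labels T) \<and>
     (\<forall>i ts. Node i ts \<in> subtrees T \<longrightarrow>
        length ts = s i + 1 \<and> (\<forall>t\<in>set ts. \<forall>x\<in>set (labels t). x < i))"

abbreviation lab :: "ltree \<Rightarrow> nat set" where
  "lab T \<equiv> set (labels T)"

lemma decreasing_tree_iff: "decreasing_tree n s T \<longleftrightarrow> ordered_tree s T \<and> lab T = {1..n}"
  by (auto simp: decreasing_tree_def ordered_tree_def)

lemma distinct_concat_map_iff:
  "distinct (concat (map f ts)) \<longleftrightarrow> (\<forall>t\<in>set ts. distinct (f t)) \<and>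
     (\<forall>p q. p < q \<and> q < length ts \<longrightarrow> set (f (ts ! p)) \<inter> set (f (ts ! q)) = {})"
proof (induction ts)
  case (Cons t ts)
  have "(\<forall>p q. p < q \<and> q < Suc (length ts) \<longrightarrow>
      set (f ((t # ts) ! p)) \<inter> set (f ((t # ts) ! q)) = {}) \<longleftrightarrow>
    (\<forall>u\<in>set ts. set (f t) \<inter> set (f u) = {}) \<and>
    (\<forall>p q. p < q \<and> q < length ts \<longrightarrow> set (f (ts ! p)) \<inter> set (f (ts ! q)) = {})"
    (is "?L \<longleftrightarrow> ?R1 \<and> ?R2")
  proof (intro iffI conjI)
    assume L: ?L
    show ?R1
    proof
      fix u assume "u \<in> set ts"
      then obtain q where "q < length ts" "ts ! q = u" by (auto simp: in_set_conv_nth)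
      then show "set (f t) \<inter> set (f u) = {}" using L[rule_format, of 0 "Suc q"] by simp
    qed
    show ?R2
    proof (intro allI impI)
      fix p q assume "p < q \<and> q < length ts"
      then show "set (f (ts ! p)) \<inter> set (f (ts ! q)) = {}"
        using L[rule_format, of "Suc p" "Suc q"] by simp
    qed
  next
    assume R: "?R1 \<and> ?R2"
    show ?L
    proof (intro allI impI)
      fix p q assume "p < q \<and> q < Suc (length ts)"
      then show "set (f ((t # ts) ! p)) \<inter> set (f ((t # ts) ! q)) = {}"
        using R by (cases p; cases q) auto
    qed
  qed
  then show ?case using Cons.IH by auto
qed simp

lemma node_in_subtrees_lab: "Node i ts \<in> subtrees T \<Longrightarrow> i \<in> lab T \<and> (\<forall>t\<in>set ts. lab t \<subseteq> lab T)"
  by (induction T) auto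

lemma node_in_subtrees_Node:
  "Node j us \<in> subtrees (Node i ts) \<longleftrightarrow>
     j = i \<and> us = ts \<or> (\<exists>k<length ts. Node j us \<in> subtrees (ts ! k))"
proof -
  have "(\<exists>t\<in>set ts. Node j us \<in> subtrees t) \<longleftrightarrow> (\<exists>k<length ts. Node j us \<in> subtrees (ts ! k))"
    by (metis in_set_conv_nth)
  then show ?thesis by simp
qed

text \<open>Replaces the quantifier over all subtrees by a recursion; distinctness of labels becomes
  disjointness of the children.\<close>

lemma ordered_tree_Node:
  "ordered_tree s (Node i ts) \<longleftrightarrow> length ts = s i + 1 \<and>
     (\<forall>t\<in>set ts. ordered_tree s t \<and> (\<forall>x\<in>lab t. x < i)) \<and>
     (\<forall>p q. p < q \<and> q < length ts \<longrightarrow> lab (ts ! p) \<inter> lab (ts ! q) = {})"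
proof -
  define Q where "Q j us \<longleftrightarrow> length us = s j + 1 \<and> (\<forall>t\<in>set us. \<forall>x\<in>lab t. x < j)" for j us
  have ordered: "ordered_tree s U \<longleftrightarrow> distinct (labels U) \<and> (\<forall>j us. Node j us \<in> subtrees U \<longrightarrow> Q j us)" for U
    by (simp add: ordered_tree_def Q_def)
  have dist: "distinct (labels (Node i ts)) \<longleftrightarrow> i \<notin> (\<Union>t\<in>set ts. lab t) \<and>
     (\<forall>t\<in>set ts. distinct (labels t)) \<and>
     (\<forall>p q. p < q \<and> q < length ts \<longrightarrow> lab (ts ! p) \<inter> lab (ts ! q) = {})"
    using distinct_concat_map_iff[of labels ts] by auto
  have nodes: "(\<forall>j us. Node j us \<in> subtrees (Node i ts) \<longrightarrow> Q j us) \<longleftrightarrow>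
      Q i ts \<and> (\<forall>t\<in>set ts. \<forall>j us. Node j us \<in> subtrees t \<longrightarrow> Q j us)"
    by auto
  have "i \<notin> (\<Union>t\<in>set ts. lab t)" if "Q i ts"
    using that by (auto simp: Q_def)
  then have "ordered_tree s (Node i ts) \<longleftrightarrow> Q i ts \<and> (\<forall>t\<in>set ts. ordered_tree s t) \<and>
     (\<forall>p q. p < q \<and> q < length ts \<longrightarrow> lab (ts ! p) \<inter> lab (ts ! q) = {})"
    unfolding ordered dist nodes by blast
  then show ?thesis by (simp add: Q_def ball_conj_distrib) blast
qed

lemma ordered_tree_Leaf [simp]: "ordered_tree s Leaf"
  by (simp add: ordered_tree_def)

lemma lab_eq_empty_iff: "lab T = {} \<longleftrightarrow> T = Leaf"
  by (cases T) auto

lemma left_of_lab: "left_of U x y \<Longrightarrow> x \<in> lab U \<and> y \<in> lab U"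
proof -
  assume "left_of U x y"
  then obtain j us p q where *: "Node j us \<in> subtrees U" "p < length us" "q < length us"
      "x \<in> lab (us ! p)" "y \<in> lab (us ! q)"
    unfolding left_of_def using less_trans by blast
  then show ?thesis using node_in_subtrees_lab[OF *(1)] nth_mem by blast
qed

lemma child_lab_subset: "k < length ts \<Longrightarrow> lab (ts ! k) \<subseteq> lab (Node i ts)"
  using nth_mem by fastforce

context
  fixes s :: "nat \<Rightarrow> nat" and i :: nat and ts :: "ltree list"
  assumes T: "ordered_tree s (Node i ts)"
begin

lemma child_lab_less: "k < length ts \<Longrightarrow> x \<in> lab (ts ! k) \<Longrightarrow> x < i"
  using T by (auto simp: ordered_tree_Node)

lemma child_ordered: "k < length ts \<Longrightarrow> ordered_tree s (ts ! k)"
  using T by (auto simp: ordered_tree_Node)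

lemma length_children: "length ts = s i + 1"
  using T by (auto simp: ordered_tree_Node)

lemma child_index_unique:
  assumes "p < length ts" "q < length ts" "x \<in> lab (ts ! p)" "x \<in> lab (ts ! q)"
  shows "p = q"
proof -
  have d: "lab (ts ! p) \<inter> lab (ts ! q) = {}" if "p < q" "q < length ts" for p q
    using T that unfolding ordered_tree_Node by blast
  show ?thesis using d[of p q] d[of q p] assms by (cases p q rule: linorder_cases) auto
qed

lemma lab_cases:
  assumes "x \<in> lab (Node i ts)"
  obtains "x = i" | k where "k < length ts" "x \<in> lab (ts ! k)" "x < i"
proof -
  consider "x = i" | t where "t \<in> set ts" "x \<in> lab t" using assms by auto
  then show thesis
  proof cases
    case (2 t)
    then obtain k where "k < length ts" "ts ! k = t" by (auto simp only: in_set_conv_nth)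
    then show thesis using that(2)[of k] child_lab_less[of k x] 2 by simp
  qed (rule that(1))
qed

lemma left_of_Node:
  "left_of (Node i ts) x y \<longleftrightarrow>
     (\<exists>p q. p < q \<and> q < length ts \<and> x \<in> lab (ts ! p) \<and> y \<in> lab (ts ! q)) \<or>
     (\<exists>k<length ts. left_of (ts ! k) x y)"
proof
  assume "left_of (Node i ts) x y"
  then show "(\<exists>p q. p < q \<and> q < length ts \<and> x \<in> lab (ts ! p) \<and> y \<in> lab (ts ! q)) \<or>
     (\<exists>k<length ts. left_of (ts ! k) x y)"
    unfolding left_of_def node_in_subtrees_Node by metis
next
  assume "(\<exists>p q. p < q \<and> q < length ts \<and> x \<in> lab (ts ! p) \<and> y \<in> lab (ts ! q)) \<or>
     (\<exists>k<length ts. left_of (ts ! k) x y)"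
  then show "left_of (Node i ts) x y"
    unfolding left_of_def node_in_subtrees_Node by metis
qed

lemma children_root: "child (Node i ts) i j = ts ! j"
proof -
  have "children (Node i ts) i = ts"
    unfolding children_def
  proof (rule the_equality)
    fix us assume "Node i us \<in> subtrees (Node i ts)"
    moreover have False if "t \<in> set ts" "Node i us \<in> subtrees t" for t
      using node_in_subtrees_lab[OF that(2)] T that(1) by (auto simp: ordered_tree_Node)
    ultimately show "us = ts" by auto
  qed simp
  then show ?thesis by (simp add: child_def)
qed

lemma child_Node:
  assumes "k < length ts" "y \<in> lab (ts ! k)"
  shows "child (Node i ts) y j = child (ts ! k) y j"
proof -
  have "Node y us \<in> subtrees (Node i ts) \<longleftrightarrow> Node y us \<in> subtrees (ts ! k)" for us
  proof
    assume "Node y us \<in> subtrees (Node i ts)"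
    moreover have "y \<noteq> i" using child_lab_less assms by blast
    ultimately obtain m where m: "m < length ts" "Node y us \<in> subtrees (ts ! m)"
      unfolding node_in_subtrees_Node by blast
    then have "m = k"
      using child_index_unique[of m k y] node_in_subtrees_lab[OF m(2)] assms by auto
    then show "Node y us \<in> subtrees (ts ! k)" using m by simp
  qed (use assms in auto)
  then show ?thesis by (simp add: child_def children_def)
qed

text \<open>Together with \<open>inv_num_same_child\<close> and \<open>inv_num_left\<close> this
  computes \<open>inv_num\<close> recursively: at the root, within one child, and across two
  children.\<close>

lemma inv_num_root:
  assumes "k < length ts" "x \<in> lab (ts ! k)"
  shows "inv_num s (Node i ts) i x = k"
proof -
  have "i \<notin> lab (ts ! j)" if "j < length ts" for j
    using child_lab_less[OF that, of i] by auto
  then have nl: "\<not> left_of (Node i ts) x i" "\<not> left_of (Node i ts) i x"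
    unfolding left_of_Node using left_of_lab by (meson less_trans)+
  have mem: "x \<in> lab (ts ! j) \<longleftrightarrow> j = k" if "j < length ts" for j
    using child_index_unique[OF that assms(1)] assms(2) by blast
  have len: "length ts = s i + 1" by (rule length_children)
  then have mem0: "x \<in> lab (ts ! 0) \<longleftrightarrow> k = 0" "x \<in> lab (ts ! s i) \<longleftrightarrow> k = s i"
    using mem[of 0] mem[of "s i"] by auto
  have eq: "inv_num s (Node i ts) i x = (if k = 0 then 0 else if k = s i then s i
      else (THE j. 0 < j \<and> j < s i \<and> x \<in> lab (ts ! j)))"
    unfolding inv_num_def children_root mem0 using nl by simp
  have "(THE j. 0 < j \<and> j < s i \<and> x \<in> lab (ts ! j)) = k" if "k \<noteq> 0" "k \<noteq> s i"
  proof (rule the_equality)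
    show "0 < k \<and> k < s i \<and> x \<in> lab (ts ! k)" using that assms len by linarith
    show "j = k" if "0 < j \<and> j < s i \<and> x \<in> lab (ts ! j)" for j using that mem[of j] len by linarith
  qed
  then show ?thesis unfolding eq by presburger
qed

lemma inv_num_same_child:
  assumes k: "k < length ts" "x \<in> lab (ts ! k)" "y \<in> lab (ts ! k)"
  shows "inv_num s (Node i ts) y x = inv_num s (ts ! k) y x"
proof -
  have "left_of (Node i ts) u v \<longleftrightarrow> left_of (ts ! k) u v" if "u \<in> lab (ts ! k)" "v \<in> lab (ts ! k)" for u v
    using that k child_index_unique left_of_lab unfolding left_of_Node
    by (metis less_irrefl less_trans)
  then show ?thesis using k by (simp add: inv_num_def child_Node)
qed

end

lemma lab_child_subset:
  assumes "ordered_tree s T" "y \<in> lab T" "j \<le> s y"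
  shows "lab (child T y j) \<subseteq> lab T"
  using assms
proof (induction T)
  case (Node i ts)
  from lab_cases[OF Node.prems(1,2)] show ?case
  proof cases
    case 1
    then show ?thesis using length_children[OF Node.prems(1)] Node.prems
      by (auto simp: children_root[OF Node.prems(1)])
  next
    case (2 k)
    then have "lab (child (ts ! k) y j) \<subseteq> lab (ts ! k)"
      using Node child_ordered[OF Node.prems(1)] by auto
    then show ?thesis using 2 child_Node[OF Node.prems(1)] by auto
  qed
qed simp

lemma inv_num_left:
  assumes T: "ordered_tree s (Node i ts)"
    and "p < q" "q < length ts" "x \<in> lab (ts ! p)" "y \<in> lab (ts ! q)"
  shows "inv_num s (Node i ts) y x = 0" "inv_num s (Node i ts) x y = s x"
proof -
  have l: "left_of (Node i ts) x y" using assms left_of_Node[OF T] by blast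
  then show "inv_num s (Node i ts) y x = 0" by (simp add: inv_num_def)
  have "\<not> left_of (ts ! k) y x" if "k < length ts" for k
    using left_of_lab[of "ts ! k" y x] child_index_unique[OF T that] assms
    by (metis less_irrefl less_trans)
  moreover have "\<not> (p' < q' \<and> q' < length ts \<and> y \<in> lab (ts ! p') \<and> x \<in> lab (ts ! q'))" for p' q'
    using child_index_unique[OF T, of p' q y] child_index_unique[OF T, of q' p x] assms by auto
  ultimately have nl: "\<not> left_of (Node i ts) y x" using left_of_Node[OF T] by blast
  \<comment> \<open>\<open>inv_num\<close> tests for the value 0 first, so the value
    \<open>s x\<close> also requires that \<open>y\<close> avoids child 0 of
    \<open>x\<close>.\<close>
  have "y \<notin> lab (child (Node i ts) x 0)"
    using child_Node[OF T, of p x 0] lab_child_subset[OF child_ordered[OF T, of p], of x 0]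
      child_index_unique[OF T, of p q y] assms by auto
  then show "inv_num s (Node i ts) x y = s x" using l nl by (simp add: inv_num_def)
qed

text \<open>Compare the indices of the children of the root. A positive value at
  \<open>(b, a)\<close> excludes that \<open>a\<close> lies in an earlier child than
  \<open>b\<close>, and a value below \<open>s b\<close> excludes a later one. A label
  \<open>c\<close> in a different child sees only 0 or \<open>s c\<close>, monotonically in the
  index; a common child is left to induction.\<close>

lemma is_tree_inv_inv_num:
  assumes "ordered_tree s T"
  shows "is_tree_inv (lab T) s (inv_num s T)"
  using assms
proof (induction T)
  case Leaf
  then show ?case by (simp add: is_tree_inv_def)
next
  case (Node i ts)
  note T = Node.prems
  let ?I = "inv_num s (Node i ts)"
  note root = inv_num_root[OF T] and same = inv_num_same_child[OF T] and left = inv_num_left[OF T]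
  note len = length_children[OF T]
  have IH: "is_tree_inv (lab (ts ! k)) s (inv_num s (ts ! k))" if "k < length ts" for k
    using Node.IH that child_ordered[OF T] by simp
  have idx: "\<exists>k<length ts. x \<in> lab (ts ! k)" if "x \<in> lab (Node i ts)" "x < y" "y \<in> lab (Node i ts)" for x y
    using lab_cases[OF T that(1)] lab_cases[OF T that(3)] that(2) by (metis less_asym less_irrefl)
  show ?case
  proof (rule is_tree_invI)
    fix x y assume xy: "x \<in> lab (Node i ts)" "y \<in> lab (Node i ts)" "x < y"
    obtain p where p: "p < length ts" "x \<in> lab (ts ! p)" using idx xy by blast
    from lab_cases[OF T xy(2)] show "?I y x \<le> s y"
    proof cases
      case 1
      then show ?thesis using root[OF p] p len by auto
    next
      case (2 q)
      then show ?thesis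
        using left[of p q x y] left[of q p y x] same[of p x y] p is_tree_inv_bound[OF IH[OF p(1)], of x y] xy
        by (cases p q rule: linorder_cases) auto
    qed
  next
    fix a b c assume abc: "a \<in> lab (Node i ts)" "b \<in> lab (Node i ts)" "c \<in> lab (Node i ts)"
      "a < b" "b < c" and pos: "0 < ?I b a"
    obtain p where p: "p < length ts" "a \<in> lab (ts ! p)" using idx abc by blast
    obtain q where q: "q < length ts" "b \<in> lab (ts ! q)" using idx abc by blast
    have qp: "q \<le> p" using left(1)[of p q a b] p q pos by (cases "p < q") auto
    from lab_cases[OF T abc(3)] show "?I c b \<le> ?I c a"
    proof cases
      case 1
      then show ?thesis using root[OF p] root[OF q] qp by simp
    next
      case (2 r)
      have bd: "?I c b \<le> s c"
        using left[of q r b c] left[of r q c b] same[of q b c] q 2 is_tree_inv_bound[OF IH[OF q(1)], of b c] abc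
        by (cases q r rule: linorder_cases) auto
      consider "r < p" | "p = r" "q = r" | "p = r" "q < r" | "p < r" using qp by linarith
      then show ?thesis
      proof cases
        case 2: 2
        then show ?thesis
          using same[of r] p q \<open>c \<in> lab (ts ! r)\<close> pos abc is_tree_inv_trans[OF IH[of r], of a b c] by auto
      qed (use left[of r p c a] left[of q r b c] 2 p q bd qp in auto)
    qed
  next
    fix a b c assume abc: "a \<in> lab (Node i ts)" "b \<in> lab (Node i ts)" "c \<in> lab (Node i ts)"
      "a < b" "b < c" and lt: "?I b a < s b"
    obtain p where p: "p < length ts" "a \<in> lab (ts ! p)" using idx abc by blast
    obtain q where q: "q < length ts" "b \<in> lab (ts ! q)" using idx abc by blast
    have pq: "p \<le> q" using left(2)[of q p b a] p q lt by (cases "q < p") auto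
    from lab_cases[OF T abc(3)] show "?I c a \<le> ?I c b"
    proof cases
      case 1
      then show ?thesis using root[OF p] root[OF q] pq by simp
    next
      case (2 r)
      have bd: "?I c a \<le> s c"
        using left[of p r a c] left[of r p c a] same[of p a c] p 2 is_tree_inv_bound[OF IH[OF p(1)], of a c] abc
        by (cases p r rule: linorder_cases) auto
      consider "p < r" | "p = r" "q = r" | "p = r" "r < q" | "r < p" using pq by linarith
      then show ?thesis
      proof cases
        case 2: 2
        then show ?thesis
          using same[of r] p q \<open>c \<in> lab (ts ! r)\<close> lt abc is_tree_inv_planar[OF IH[of r], of a b c] by auto
      qed (use left[of p r a c] left[of r q c b] 2 p q bd pq in auto)
    qed
  qed
qed

text \<open>The root is the largest label, and the values at the root determine the label set of
  each child; then recurse.\<close>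

lemma inv_num_inj:
  assumes "ordered_tree s T" "ordered_tree s W" "lab T = lab W"
    and "\<And>x y. x \<in> lab T \<Longrightarrow> y \<in> lab T \<Longrightarrow> x < y \<Longrightarrow> inv_num s T y x = inv_num s W y x"
  shows "T = W"
  using assms
proof (induction T arbitrary: W)
  case Leaf
  then show ?case using lab_eq_empty_iff by (metis labels.simps(1) list.set(1))
next
  case (Node i ts)
  then obtain j us where W: "W = Node j us" by (cases W) auto
  note T = Node.prems(1) and O = Node.prems(2)[unfolded W] and eq = Node.prems(3)[unfolded W]
  have "i \<in> lab (Node j us)" "j \<in> lab (Node i ts)" using eq by auto
  then have "i = j"
    using lab_cases[OF T, of j] lab_cases[OF O, of i] by (metis less_asym)
  have len: "length ts = length us" using length_children[OF T] length_children[OF O] \<open>i = j\<close> by simp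
  have labs: "lab (ts ! k) = lab (us ! k)" if k: "k < length ts" for k
  proof -
    have 1: "lab (ts ! k) = {x \<in> lab (Node i ts). x < i \<and> inv_num s (Node i ts) i x = k}"
    proof (intro subset_antisym subsetI)
      fix x assume "x \<in> {x \<in> lab (Node i ts). x < i \<and> inv_num s (Node i ts) i x = k}"
      then show "x \<in> lab (ts ! k)"
        using lab_cases[OF T, of x] inv_num_root[OF T] by (metis (mono_tags, lifting) less_irrefl mem_Collect_eq)
    qed (use k child_lab_less[OF T k] inv_num_root[OF T k] in auto)
    have 2: "lab (us ! k) = {x \<in> lab (Node j us). x < j \<and> inv_num s (Node j us) j x = k}"
    proof (intro subset_antisym subsetI)
      fix x assume "x \<in> {x \<in> lab (Node j us). x < j \<and> inv_num s (Node j us) j x = k}"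
      then show "x \<in> lab (us ! k)"
        using lab_cases[OF O, of x] inv_num_root[OF O] by (metis (mono_tags, lifting) less_irrefl mem_Collect_eq)
    qed (use k len child_lab_less[OF O] inv_num_root[OF O] in auto)
    show ?thesis
    proof -
      have "inv_num s (Node i ts) i x = inv_num s (Node j us) j x" if "x \<in> lab (Node j us)" "x < i" for x
      proof -
        have "x \<in> lab (Node i ts)" "i \<in> lab (Node i ts)" 
          unfolding eq using that(1) \<open>i \<in> lab (Node j us)\<close> by blast+
        from Node.prems(4)[OF this that(2)] show ?thesis using W \<open>i = j\<close> by simp
      qed
      then show ?thesis unfolding 1 2 eq \<open>i = j\<close>[symmetric] by (metis (mono_tags, lifting))
    qed
  qed
  have "ts ! k = us ! k" if k: "k < length ts" for k
  proof (rule Node.IH)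
    show "ts ! k \<in> set ts" using k by simp
    show "ordered_tree s (ts ! k)" "ordered_tree s (us ! k)"
      using child_ordered[OF T] child_ordered[OF O] k len by auto
    show "lab (ts ! k) = lab (us ! k)" by (rule labs[OF k])
    show "inv_num s (ts ! k) y x = inv_num s (us ! k) y x"
      if "x \<in> lab (ts ! k)" "y \<in> lab (ts ! k)" "x < y" for x y
    proof -
      have "x \<in> lab (Node i ts)" "y \<in> lab (Node i ts)" using child_lab_subset[OF k, of i] that by auto
      from Node.prems(4)[OF this that(3)] show ?thesis
        using inv_num_same_child[OF T k, of x y] inv_num_same_child[OF O, of k x y] that labs[OF k] k len W
        by simp
    qed
  qed
  then show ?case using W \<open>i = j\<close> len by (auto intro: nth_equalityI)
qed

text \<open>The largest label \<open>m\<close> becomes the root and \<open>{x. I m x = k}\<close>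
  the label set of child \<open>k\<close>. Transitivity and planarity with \<open>c = m\<close> are
  exactly what makes \<open>I\<close> take the values 0 and \<open>s y\<close> across different
  children.\<close>

lemma ex_ordered_tree:
  assumes "finite A" "is_tree_inv A s I"
  shows "\<exists>T. ordered_tree s T \<and> lab T = A \<and>
    (\<forall>x\<in>A. \<forall>y\<in>A. x < y \<longrightarrow> inv_num s T y x = I y x)"
  using assms
proof (induction A rule: finite_psubset_induct)
  case (psubset A)
  show ?case
  proof (cases "A = {}")
    case True
    then show ?thesis by (intro exI[of _ Leaf]) auto
  next
    case False
    define m where "m = Max A"
    have m: "m \<in> A" "\<And>x. x \<in> A \<Longrightarrow> x \<le> m" using psubset.hyps False by (auto simp: m_def)
    define B where "B k = {x \<in> A. x < m \<and> I m x = k}" for k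
    have "\<exists>t. ordered_tree s t \<and> lab t = B k \<and>
      (\<forall>x\<in>B k. \<forall>y\<in>B k. x < y \<longrightarrow> inv_num s t y x = I y x)" for k
    proof (rule psubset.IH)
      show "B k \<subset> A" using m by (auto simp: B_def)
      then show "is_tree_inv (B k) s I"
        using psubset.prems unfolding is_tree_inv_def by (meson psubsetD)
    qed
    then obtain t where t: "\<And>k. ordered_tree s (t k)" "\<And>k. lab (t k) = B k"
      "\<And>k x y. x \<in> B k \<Longrightarrow> y \<in> B k \<Longrightarrow> x < y \<Longrightarrow> inv_num s (t k) y x = I y x"
      by metis
    define ts where "ts = map t [0..<s m + 1]"
    have nth: "ts ! k = t k" if "k \<le> s m" for k using that by (simp add: ts_def nth_append)
    have O: "ordered_tree s (Node m ts)"
      unfolding ordered_tree_Node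
    proof (intro conjI allI impI)
      fix p q assume "p < q \<and> q < length ts"
      then have "p < q" "q \<le> s m" by (auto simp: ts_def)
      then show "lab (ts ! p) \<inter> lab (ts ! q) = {}"
        by (auto simp: nth t B_def)
    qed (auto simp: ts_def t B_def)
    have len: "length ts = s m + 1" by (simp add: ts_def)
    have bd: "x \<in> A \<Longrightarrow> x < m \<Longrightarrow> I m x \<le> s m" for x
      using is_tree_inv_bound[OF psubset.prems] m by auto
    have "lab (Node m ts) = insert m (\<Union>k\<in>{0..<s m + 1}. B k)"
      by (simp add: ts_def t del: upt_Suc)
    also have "\<dots> = A"
      using m bd by (fastforce simp: B_def less_Suc_eq_le le_less)
    finally have "lab (Node m ts) = A" .
    moreover have "inv_num s (Node m ts) y x = I y x" if xy: "x \<in> A" "y \<in> A" "x < y" for x y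
    proof -
      have "x < m" using xy m(2)[of y] by auto
      define p where "p = I m x"
      have p: "p < length ts" "p \<le> s m" "x \<in> lab (ts ! p)"
        using bd[of x] xy \<open>x < m\<close> by (auto simp: p_def len nth t B_def)
      show ?thesis
      proof (cases "y = m")
        case True
        then show ?thesis using inv_num_root[OF O p(1,3)] by (simp add: p_def)
      next
        case False
        then have "y < m" using xy m(2)[of y] by auto
        define q where "q = I m y"
        have q: "q < length ts" "q \<le> s m" "y \<in> lab (ts ! q)"
          using bd[of y] xy \<open>y < m\<close> by (auto simp: q_def len nth t B_def)
        show ?thesis
        proof (cases p q rule: linorder_cases)
          case less
          then have "I y x = 0"
            using is_tree_inv_trans[OF psubset.prems, of x y m] xy m \<open>y < m\<close> by (auto simp: p_def q_def)
          then show ?thesis using inv_num_left(1)[OF O less] p q by simp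
        next
          case equal
          then have "x \<in> B p" "y \<in> B p" using p q nth t by auto
          then show ?thesis
            using inv_num_same_child[OF O p(1,3), of y] equal q t(3)[of x p y] xy nth[OF p(2)] by auto
        next
          case greater
          then have "I y x = s y"
            using is_tree_inv_planar[OF psubset.prems, of x y m] xy m \<open>y < m\<close> by (fastforce simp: p_def q_def)
          then show ?thesis using inv_num_left(2)[OF O greater] p q by simp
        qed
      qed
    qed
    ultimately show ?thesis using O by blast
  qed
qed

text \<open>Shows that \<open>inv_desc\<close> is ancestry. In the induction, labels outside the
  child \<open>ts ! k\<close> cannot distinguish between labels inside it.\<close>

lemma mem_child_iff:
  assumes "ordered_tree s T" "y \<in> lab T" "j \<le> s y"
  shows "x \<in> lab (child T y j) \<longleftrightarrow> inv_desc (lab T) (inv_num s T) y x \<and> inv_num s T y x = j"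
  using assms
proof (induction T)
  case (Node i ts)
  note T = Node.prems(1)
  note root = inv_num_root[OF T] and same = inv_num_same_child[OF T] and left = inv_num_left[OF T]
  from lab_cases[OF T Node.prems(2)] show ?case
  proof cases
    case 1
    have "x \<in> lab (ts ! j) \<longleftrightarrow> x \<in> lab (Node i ts) \<and> x < i \<and> inv_num s (Node i ts) i x = j"
    proof
      assume "x \<in> lab (ts ! j)"
      then show "x \<in> lab (Node i ts) \<and> x < i \<and> inv_num s (Node i ts) i x = j"
        using root[of j x] child_lab_less[OF T, of j x] length_children[OF T] Node.prems 1 by auto
    next
      assume "x \<in> lab (Node i ts) \<and> x < i \<and> inv_num s (Node i ts) i x = j"
      then show "x \<in> lab (ts ! j)" using lab_cases[OF T, of x] root by (metis less_irrefl)
    qed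
    moreover have "\<not> i < c" if "c \<in> lab (Node i ts)" for c
      using lab_cases[OF T that] by (metis less_asym less_irrefl)
    ultimately show ?thesis using 1 by (auto simp: children_root[OF T] inv_desc_def)
  next
    case (2 k)
    note k = 2(1,2)
    have IH: "x \<in> lab (child (ts ! k) y j) \<longleftrightarrow>
        inv_desc (lab (ts ! k)) (inv_num s (ts ! k)) y x \<and> inv_num s (ts ! k) y x = j"
      using Node.IH[of "ts ! k"] k child_ordered[OF T] Node.prems by auto
    have "inv_desc (lab (Node i ts)) (inv_num s (Node i ts)) y x \<longleftrightarrow>
      inv_desc (lab (ts ! k)) (inv_num s (ts ! k)) y x"
    proof
      assume d: "inv_desc (lab (Node i ts)) (inv_num s (Node i ts)) y x"
      then have "x \<in> lab (Node i ts)" "x < y" by (auto simp: inv_desc_def)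
      then obtain p where p: "p < length ts" "x \<in> lab (ts ! p)"
        using lab_cases[OF T, of x] 2 by (metis less_asym)
      have "inv_num s (Node i ts) i x = inv_num s (Node i ts) i y"
        using d 2 by (auto simp: inv_desc_def)
      then have "p = k" using root[OF p] root[OF k] by simp
      then have x: "x \<in> lab (ts ! k)" using p by simp
      have "inv_num s (ts ! k) c x = inv_num s (ts ! k) c y" if c: "c \<in> lab (ts ! k)" "y < c" for c
        using d c child_lab_subset[OF k(1), of i] same[OF k(1) x c(1)] same[OF k c(1)]
        unfolding inv_desc_def by auto
      then show "inv_desc (lab (ts ! k)) (inv_num s (ts ! k)) y x"
        using \<open>x < y\<close> x k unfolding inv_desc_def by blast
    next
      assume d: "inv_desc (lab (ts ! k)) (inv_num s (ts ! k)) y x"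
      then have x: "x \<in> lab (ts ! k)" "x < y" by (auto simp: inv_desc_def)
      have "inv_num s (Node i ts) c x = inv_num s (Node i ts) c y"
        if c: "c \<in> lab (Node i ts)" "y < c" for c
        using lab_cases[OF T c(1)]
      proof cases
        case 1
        then show ?thesis using root[OF k(1)] k x by simp
      next
        case (2 r)
        then show ?thesis
          using d c same[OF k(1), of x c] same[OF k(1), of y c] k x
            left[of k r x c] left[of k r y c] left[of r k c x] left[of r k c y]
          by (cases k r rule: linorder_cases) (auto simp: inv_desc_def)
      qed
      then show "inv_desc (lab (Node i ts)) (inv_num s (Node i ts)) y x"
        using x k child_lab_subset[OF k(1), of i] unfolding inv_desc_def by blast
    qed
    then show ?thesis
      using IH child_Node[OF T k] same[OF k(1) _ k(2), of x] by (auto simp: inv_desc_def)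
  qed
qed simp

section \<open>Translation between multi-inversion sets and inversion functions\<close>

lemma count_tree_inv_Icc:
  "count (tree_inv n s T) (y, x) = (if x \<in> {1..n} \<and> y \<in> {1..n} \<and> x < y then inv_num s T y x else 0)"
  by (auto simp: count_tree_inv inv_pairs_def)

lemma weak_le_iff: "weak_le n s T W \<longleftrightarrow> inv_le {1..n} (inv_num s T) (inv_num s W)"
  unfolding weak_le_def subseteq_mset_def inv_le_def by (auto simp: count_tree_inv_Icc)

lemma inv_transitive_iff: "inv_transitive n K \<longleftrightarrow> inv_trans {1..n} (\<lambda>y x. count K (y, x))"
proof -
  have "1 \<le> a \<and> a < b \<and> b < c \<and> c \<le> n \<longleftrightarrow>
      a \<in> {1..n} \<and> b \<in> {1..n} \<and> c \<in> {1..n} \<and> a < b \<and> b < c" for a b c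
    by auto
  then show ?thesis unfolding inv_transitive_def inv_trans_def by blast
qed

lemma decreasing_tree_is_tree_inv: "decreasing_tree n s T \<Longrightarrow> is_tree_inv {1..n} s (inv_num s T)"
  using is_tree_inv_inv_num[of s T] by (simp add: decreasing_tree_iff)

lemma weak_le_antisym:
  assumes "decreasing_tree n s T" "decreasing_tree n s W" "weak_le n s T W" "weak_le n s W T"
  shows "T = W"
proof (rule inv_num_inj)
  show "ordered_tree s T" "ordered_tree s W" "lab T = lab W"
    using assms by (auto simp: decreasing_tree_iff)
  show "inv_num s T y x = inv_num s W y x" if "x \<in> lab T" "y \<in> lab T" "x < y" for x y
    using assms that by (auto simp: decreasing_tree_iff weak_le_iff inv_le_def intro: le_antisym)
qed

lemma inv_le_refl: "inv_le A I I"
  by (simp add: inv_le_def)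

lemma inv_le_trans: "inv_le A I J \<Longrightarrow> inv_le A J K \<Longrightarrow> inv_le A I K"
  unfolding inv_le_def by (meson le_trans)

definition tree_of :: "nat \<Rightarrow> (nat \<Rightarrow> nat) \<Rightarrow> (nat \<Rightarrow> nat \<Rightarrow> nat) \<Rightarrow> ltree" where
  "tree_of n s I = (SOME W. decreasing_tree n s W \<and>
     (\<forall>x\<in>{1..n}. \<forall>y\<in>{1..n}. x < y \<longrightarrow> inv_num s W y x = I y x))"

lemma tree_of:
  assumes "is_tree_inv {1..n} s I"
  shows "decreasing_tree n s (tree_of n s I)"
    and "\<And>x y. x \<in> {1..n} \<Longrightarrow> y \<in> {1..n} \<Longrightarrow> x < y \<Longrightarrow> inv_num s (tree_of n s I) y x = I y x"
proof -
  have "\<exists>W. decreasing_tree n s W \<and> (\<forall>x\<in>{1..n}. \<forall>y\<in>{1..n}. x < y \<longrightarrow> inv_num s W y x = I y x)"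
    using ex_ordered_tree[OF finite_atLeastAtMost assms] by (simp only: decreasing_tree_iff) blast
  from someI_ex[OF this, folded tree_of_def]
  show "decreasing_tree n s (tree_of n s I)"
    and "\<And>x y. x \<in> {1..n} \<Longrightarrow> y \<in> {1..n} \<Longrightarrow> x < y \<Longrightarrow> inv_num s (tree_of n s I) y x = I y x"
    by blast+
qed

lemma tree_of_le_iff:
  assumes "is_tree_inv {1..n} s I"
  shows "inv_le {1..n} (inv_num s (tree_of n s I)) K \<longleftrightarrow> inv_le {1..n} I K"
    and "inv_le {1..n} K (inv_num s (tree_of n s I)) \<longleftrightarrow> inv_le {1..n} K I"
  unfolding inv_le_def using tree_of(2)[OF assms] by auto

text \<open>Closures are evaluated by naming the result. Multi-inversion sets vanish outside the
  inversion pairs, so comparing functions on \<open>{1..n}\<close> suffices.\<close>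

lemma inv_tc_tree_of:
  assumes J: "is_tree_inv {1..n} s J" and M: "multi_inv_set n M"
    and le: "inv_le {1..n} (\<lambda>y x. count M (y, x)) J"
    and least: "\<And>K. inv_trans {1..n} K \<Longrightarrow> inv_le {1..n} (\<lambda>y x. count M (y, x)) K \<Longrightarrow> inv_le {1..n} J K"
  shows "inv_tc n M = tree_inv n s (tree_of n s J)"
proof -
  let ?W = "tree_inv n s (tree_of n s J)"
  have cW: "count ?W (y, x) = (if x \<in> {1..n} \<and> y \<in> {1..n} \<and> x < y then J y x else 0)" for x y
    using tree_of(2)[OF J] by (auto simp: count_tree_inv_Icc)
  have supp: "count K (y, x) = 0" if "multi_inv_set n K" "\<not> (x \<in> {1..n} \<and> y \<in> {1..n} \<and> x < y)" for K x y
    using that unfolding multi_inv_set_def inv_pairs_def by (auto simp: count_eq_zero_iff)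
  have mW: "multi_inv_set n ?W"
    unfolding multi_inv_set_def
  proof (rule subrelI)
    fix y x assume "(y, x) \<in># ?W"
    then have "count ?W (y, x) \<noteq> 0" by simp
    then show "(y, x) \<in> inv_pairs n" by (auto simp: count_tree_inv split: if_splits)
  qed
  have tW: "inv_transitive n ?W"
    using is_tree_inv_imp_inv_trans[OF J] unfolding inv_transitive_iff inv_trans_def by (simp add: cW)
  have MW: "M \<subseteq># ?W"
    unfolding subseteq_mset_def
  proof
    fix p :: "nat \<times> nat"
    obtain y x where "p = (y, x)" by (cases p)
    then show "count M p \<le> count ?W p" using le supp[OF M, of x y] by (auto simp: cW inv_le_def)
  qed
  have WK: "?W \<subseteq># K" if "multi_inv_set n K" "inv_transitive n K" "M \<subseteq># K" for K
    unfolding subseteq_mset_def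
  proof
    have "inv_le {1..n} J (\<lambda>y x. count K (y, x))"
      using that unfolding inv_transitive_iff subseteq_mset_def by (intro least) (auto simp: inv_le_def)
    then show "count ?W p \<le> count K p" for p :: "nat \<times> nat" by (cases p) (auto simp: cW inv_le_def)
  qed
  have "is_inv_tc n M ?W" using mW tW MW WK by (simp add: is_inv_tc_def)
  then show ?thesis
    using is_inv_tc_inv_tc[OF M] unfolding is_inv_tc_def by (meson subset_mset.antisym)
qed

lemma multi_inv_set_inv_plus: "multi_inv_set n (inv_plus n s I J)"
  unfolding multi_inv_set_def
proof (rule subrelI)
  fix y x assume "(y, x) \<in># inv_plus n s I J"
  then have "(y, x) \<in># max_inv n s" by (simp add: inv_plus_def)
  then have "count (max_inv n s) (y, x) \<noteq> 0" by simp
  then show "(y, x) \<in> inv_pairs n" by (auto simp: count_max_inv split: if_splits)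
qed

lemma multi_inv_set_tree_inv: "multi_inv_set n (tree_inv n s T)"
  unfolding multi_inv_set_def
proof (rule subrelI)
  fix y x assume "(y, x) \<in># tree_inv n s T"
  then have "count (tree_inv n s T) (y, x) \<noteq> 0" by simp
  then show "(y, x) \<in> inv_pairs n" by (auto simp: count_tree_inv split: if_splits)
qed

lemma count_inv_plus:
  assumes "x \<in> {1..n}" "y \<in> {1..n}" "x < y"
  shows "count (inv_plus n s I J) (y, x) = min (count I (y, x) + count J (y, x)) (s y)"
  using assms by (simp add: inv_plus_def count_max_inv inv_pairs_def)

lemma tree_ascent_iff:
  assumes T: "decreasing_tree n s T"
  shows "tree_ascent n s T (a, b) \<longleftrightarrow> inv_ascent {1..n} s (inv_num s T) a b"
proof -
  let ?I = "inv_num s T" and ?A = "{1..n}"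
  have O: "ordered_tree s T" "lab T = ?A" using T by (auto simp: decreasing_tree_iff)
  have mem: "x \<in> lab (child T y j) \<longleftrightarrow> inv_desc ?A ?I y x \<and> ?I y x = j" if "y \<in> ?A" "j \<le> s y" for x y j
    using mem_child_iff[OF O(1), of y j x] O(2) that by simp
  have desc_mem: "x \<in> ?A \<and> y \<in> ?A \<and> x < y" if "inv_desc ?A ?I y x" for x y
    using that by (simp add: inv_desc_def)
  have bd: "?I y x \<le> s y" if "x \<in> ?A" "y \<in> ?A" "x < y" for x y
    using is_tree_inv_bound[OF decreasing_tree_is_tree_inv[OF T]] that by blast
  show ?thesis
  proof (cases "a \<in> ?A \<and> b \<in> ?A \<and> a < b")
    case False
    then show ?thesis unfolding tree_ascent_def inv_ascent_def inv_desc_def by auto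
  next
    case True
    have 1: "(\<exists>i < s b. a \<in> lab (child T b i)) \<longleftrightarrow> inv_desc ?A ?I b a \<and> ?I b a < s b"
      using mem[of b] True by auto
    have 2: "(\<forall>e j. a < e \<and> e < b \<and> j \<le> s e \<and> a \<in> lab (child T e j) \<longrightarrow> j = s e) \<longleftrightarrow>
        (\<forall>e. e < b \<and> inv_desc ?A ?I e a \<longrightarrow> ?I e a = s e)" (is "?L \<longleftrightarrow> ?R")
    proof
      assume L: ?L
      show ?R
      proof (intro allI impI)
        fix e assume e: "e < b \<and> inv_desc ?A ?I e a"
        then have "a \<in> ?A" "e \<in> ?A" "a < e" using desc_mem by blast+
        then show "?I e a = s e" using L[rule_format, of e "?I e a"] mem[of e "?I e a" a] bd[of a e] e by blast
      qed
    next
      assume R: ?R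
      show ?L
      proof (intro allI impI)
        fix e j assume e: "a < e \<and> e < b \<and> j \<le> s e \<and> a \<in> lab (child T e j)"
        then have "e \<in> ?A" using True by auto
        then show "j = s e" using mem[of e j a] e R by auto
      qed
    qed
    have 3: "child T a (s a) = Leaf \<longleftrightarrow> (\<forall>x. inv_desc ?A ?I a x \<longrightarrow> ?I a x \<noteq> s a)"
    proof -
      have eq: "lab (child T a (s a)) = {x. inv_desc ?A ?I a x \<and> ?I a x = s a}"
        using mem[OF conjunct1[OF True] order_refl] by auto
      show ?thesis unfolding lab_eq_empty_iff[symmetric] eq by blast
    qed
    have "1 \<le> a \<and> a < b \<and> b \<le> n" using True by auto
    then show ?thesis unfolding tree_ascent_def inv_ascent_def case_prod_conv 1 2 3 by blast
  qed
qed

text \<open>By \<open>inv_rotate_least\<close> the explicit function is the closure. The cut-off in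
  \<open>inv_plus\<close> does not interfere with the added pair, because \<open>I b a < s b\<close>
  at an ascent.\<close>

lemma tree_inv_rotation:
  assumes T: "decreasing_tree n s T" and asc: "inv_ascent {1..n} s (inv_num s T) a b"
  shows "rotation n s T (a, b) = tree_of n s (inv_rotate (inv_num s T) a b)"
proof -
  let ?I = "inv_num s T" and ?A = "{1..n}"
  let ?M = "inv_plus n s (tree_inv n s T) {#(b, a)#}"
  have I: "is_tree_inv ?A s ?I" by (rule decreasing_tree_is_tree_inv[OF T])
  have R: "is_tree_inv ?A s (inv_rotate ?I a b)" by (rule is_tree_inv_rotate[OF I asc])
  have ab: "a \<in> ?A" "b \<in> ?A" "a < b" "?I b a < s b" using asc by (auto simp: inv_ascent_def inv_desc_def)
  have cM: "count ?M (y, x) = (if y = b \<and> x = a then ?I b a + 1 else ?I y x)"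
    if xy: "x \<in> ?A" "y \<in> ?A" "x < y" for x y
    using is_tree_inv_bound[OF I xy] ab xy by (simp add: count_inv_plus[OF xy] count_tree_inv_Icc)
  have "inv_tc n ?M = tree_inv n s (tree_of n s (inv_rotate ?I a b))"
  proof (rule inv_tc_tree_of[OF R multi_inv_set_inv_plus])
    show "inv_le ?A (\<lambda>y x. count ?M (y, x)) (inv_rotate ?I a b)"
      using cM by (auto simp: inv_le_def inv_rotate_def)
    fix K assume K: "inv_trans ?A K" "inv_le ?A (\<lambda>y x. count ?M (y, x)) K"
    have "?I y x \<le> K y x" if "x \<in> ?A" "y \<in> ?A" "x < y" for x y
      using K(2) cM[OF that] that unfolding inv_le_def by (metis Suc_eq_plus1 Suc_leD)
    then have "inv_le ?A ?I K" by (simp add: inv_le_def)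
    moreover have "?I b a < K b a"
      using K(2) cM[of a b] ab unfolding inv_le_def by force
    ultimately show "inv_le ?A (inv_rotate ?I a b) K"
      using inv_rotate_least[OF K(1)] ab by blast
  qed
  then have *: "decreasing_tree n s (tree_of n s (inv_rotate ?I a b)) \<and>
      tree_inv n s (tree_of n s (inv_rotate ?I a b)) = inv_tc n ?M"
    using tree_of(1)[OF R] by simp
  show ?thesis
    unfolding rotation_def case_prod_conv
  proof (rule the_equality)
    show "decreasing_tree n s (tree_of n s (inv_rotate ?I a b)) \<and>
      tree_inv n s (tree_of n s (inv_rotate ?I a b)) = inv_tc n ?M" by (rule *)
    fix W assume W: "decreasing_tree n s W \<and> tree_inv n s W = inv_tc n ?M"
    then show "W = tree_of n s (inv_rotate ?I a b)"
      using * by (intro weak_le_antisym[of n s]) (auto simp: weak_le_def)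
  qed
qed

lemma rotation_set_iff:
  assumes T: "decreasing_tree n s T" and asc: "inv_ascent {1..n} s (inv_num s T) a b"
    and xy: "x \<in> {1..n}" "y \<in> {1..n}" "x < y"
  shows "(y, x) \<in> rotation_set n s T (a, b) \<longleftrightarrow> inv_rotate (inv_num s T) a b y x \<noteq> inv_num s T y x"
proof -
  let ?I = "inv_num s T"
  have R: "is_tree_inv {1..n} s (inv_rotate ?I a b)"
    by (rule is_tree_inv_rotate[OF decreasing_tree_is_tree_inv[OF T] asc])
  have "count (tree_inv n s (rotation n s T (a, b))) (y, x) = inv_rotate ?I a b y x"
    using tree_of(2)[OF R xy] xy by (simp add: tree_inv_rotation[OF T asc] count_tree_inv_Icc)
  moreover have "?I y x \<le> inv_rotate ?I a b y x" by (simp add: inv_rotate_def)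
  ultimately show ?thesis using xy by (auto simp: rotation_set_def count_tree_inv_Icc)
qed

text \<open>By disjointness each pair is raised at most once, and a raised value is still bounded by
  \<open>s y\<close> because it occurs in a rotated tree. So the truncated sum is the pointwise
  maximum of the rotations, or \<open>inv_num s T\<close> itself if \<open>ps\<close> is
  empty.\<close>

lemma count_foldl_rotation_sets:
  assumes T: "decreasing_tree n s T"
    and "\<And>a b. (a, b) \<in> set ps \<Longrightarrow> inv_ascent {1..n} s (inv_num s T) a b" and "distinct ps"
    and xy: "x \<in> {1..n}" "y \<in> {1..n}" "x < y"
  shows "count (foldl (inv_plus n s) (tree_inv n s T) (map (\<lambda>p. mset_set (rotation_set n s T p)) ps)) (y, x) =
    (if \<exists>(a, b)\<in>set ps. inv_rotate (inv_num s T) a b y x \<noteq> inv_num s T y x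
     then inv_num s T y x + 1 else inv_num s T y x)"
  using assms(2,3)
proof (induction ps rule: rev_induct)
  case Nil
  then show ?case using xy by (simp add: count_tree_inv_Icc)
next
  case (snoc p ps)
  let ?I = "inv_num s T"
  have I: "is_tree_inv {1..n} s ?I" by (rule decreasing_tree_is_tree_inv[OF T])
  obtain a b where p: "p = (a, b)" by (cases p)
  have asc: "inv_ascent {1..n} s ?I a b" using snoc.prems(1) p by simp
  have R: "is_tree_inv {1..n} s (inv_rotate ?I a b)" by (rule is_tree_inv_rotate[OF I asc])
  have up: "inv_rotate ?I a b y x = ?I y x + 1" if "inv_rotate ?I a b y x \<noteq> ?I y x"
    using that by (auto simp: inv_rotate_def split: if_splits)
  have bd: "?I y x \<le> s y" "inv_rotate ?I a b y x \<le> s y"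
    using is_tree_inv_bound[OF I xy] is_tree_inv_bound[OF R xy] by auto
  have bd': "?I y x + 1 \<le> s y" if "(a', b') \<in> set ps" "inv_rotate ?I a' b' y x \<noteq> ?I y x" for a' b'
  proof -
    have "inv_ascent {1..n} s ?I a' b'" using snoc.prems(1) that by simp
    from is_tree_inv_bound[OF is_tree_inv_rotate[OF I this] xy] show ?thesis
      using that(2) by (auto simp: inv_rotate_def split: if_splits)
  qed
  have dis: "inv_rotate ?I a b y x = ?I y x"
    if "(a', b') \<in> set ps" "inv_rotate ?I a' b' y x \<noteq> ?I y x" for a' b'
  proof (rule inv_rotate_disjoint[OF I _ asc _ _ that(2)])
    show "inv_ascent {1..n} s ?I a' b'" using snoc.prems(1) that by simp
    show "(a', b') \<noteq> (a, b)" using snoc.prems(2) p that by auto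
  qed (rule xy)
  have "count (mset_set (rotation_set n s T p)) (y, x) = (if inv_rotate ?I a b y x \<noteq> ?I y x then 1 else 0)"
    using rotation_set_iff[OF T asc xy] finite_rotation_set[of n s T p] by (simp add: p)
  then show ?case
    using snoc.IH snoc.prems bd bd' dis up
    by (auto simp: count_inv_plus[OF xy] p split: if_splits)
qed

section \<open>Realizations of finite posets\<close>

lemma continuous_map_Min:
  fixes f :: "'i \<Rightarrow> 'a \<Rightarrow> real"
  assumes "finite I" "I \<noteq> {}" "\<And>i. i \<in> I \<Longrightarrow> continuous_map X euclideanreal (f i)"
  shows "continuous_map X euclideanreal (\<lambda>x. Min ((\<lambda>i. f i x) ` I))"
  using assms
proof (induction I rule: finite_ne_induct)
  case (insert i I)
  then have "continuous_map X euclideanreal (\<lambda>x. min (f i x) (Min ((\<lambda>i. f i x) ` I)))"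
    by (intro continuous_intros) auto
  then show ?case using insert.hyps by simp
qed simp

lemma continuous_map_Max:
  fixes f :: "'i \<Rightarrow> 'a \<Rightarrow> real"
  assumes "finite I" "I \<noteq> {}" "\<And>i. i \<in> I \<Longrightarrow> continuous_map X euclideanreal (f i)"
  shows "continuous_map X euclideanreal (\<lambda>x. Max ((\<lambda>i. f i x) ` I))"
  using assms
proof (induction I rule: finite_ne_induct)
  case (insert i I)
  then have "continuous_map X euclideanreal (\<lambda>x. max (f i x) (Max ((\<lambda>i. f i x) ` I)))"
    by (intro continuous_intros) auto
  then show ?case using insert.hyps by simp
qed simp

locale finite_order =
  fixes P :: "'a set" and le :: "'a \<Rightarrow> 'a \<Rightarrow> bool"
  assumes finite_P: "finite P"
    and le_refl: "p \<in> P \<Longrightarrow> le p p"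
    and le_trans: "p \<in> P \<Longrightarrow> q \<in> P \<Longrightarrow> r \<in> P \<Longrightarrow> le p q \<Longrightarrow> le q r \<Longrightarrow> le p r"
    and le_antisym: "p \<in> P \<Longrightarrow> q \<in> P \<Longrightarrow> le p q \<Longrightarrow> le q p \<Longrightarrow> p = q"
begin

abbreviation realization :: "('a \<Rightarrow> real) topology" where
  "realization \<equiv> geometric_realization (order_complex P le)"

lemma Union_order_complex: "\<Union>(order_complex P le) = P"
proof -
  have "{p} \<in> order_complex P le" if "p \<in> P" for p
    using that le_refl by (simp add: order_complex_def Complete_Partial_Order.chain_def)
  then show ?thesis by (auto simp: order_complex_def)
qed

lemma mem_realization:
  "x \<in> topspace realization \<longleftrightarrow> x \<in> extensional P \<and> (\<forall>p\<in>P. 0 \<le> x p) \<and> sum x P = 1 \<and>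
     (\<forall>p\<in>P. \<forall>q\<in>P. x p \<noteq> 0 \<and> x q \<noteq> 0 \<longrightarrow> le p q \<or> le q p)"
proof -
  have "(\<Sum>v | v \<in> P \<and> x v \<noteq> 0. x v) = sum x P"
    using finite_P by (intro sum.mono_neutral_left) auto
  moreover have "{v \<in> P. x v \<noteq> 0} \<noteq> {}" if "sum x P = 1"
    using that by (metis (mono_tags, lifting) empty_iff mem_Collect_eq sum.neutral zero_neq_one)
  ultimately show ?thesis
    unfolding geometric_realization_def Union_order_complex
    using finite_P
    by (auto simp: PiE_def order_complex_def Complete_Partial_Order.chain_def)
qed

lemma continuous_map_realization_iff:
  "continuous_map X realization f \<longleftrightarrow>
     f ` topspace X \<subseteq> topspace realization \<and> (\<forall>p\<in>P. continuous_map X euclideanreal (\<lambda>x. f x p))"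
proof -
  have "topspace realization \<subseteq> extensional P" using mem_realization by blast
  then show ?thesis
    unfolding geometric_realization_def Union_order_complex
    by (auto simp: continuous_map_in_subtopology continuous_map_componentwise image_subset_iff PiE_iff)
qed

lemma continuous_map_coordinate:
  "p \<in> P \<Longrightarrow> continuous_map realization euclideanreal (\<lambda>x. x p)"
  using continuous_map_realization_iff[of realization "\<lambda>x. x"] by simp

lemma topspace_realization_nonempty:
  assumes "P \<noteq> {}"
  shows "topspace realization \<noteq> {}"
proof -
  obtain j where j: "j \<in> P" using assms by blast
  have "(\<lambda>q\<in>P. if q = j then 1 else 0) \<in> topspace realization"
    unfolding mem_realization using j finite_P le_refl by auto
  then show ?thesis by blast
qed

lemma topspace_realization_empty:
  assumes "P = {}"
  shows "topspace realization = {}"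
  using mem_realization assms by (metis equals0I sum.empty zero_neq_one)

text \<open>The simplicial map induced by the vertex map \<open>f\<close>, in barycentric
  coordinates.\<close>

definition push :: "('a \<Rightarrow> 'a) \<Rightarrow> ('a \<Rightarrow> real) \<Rightarrow> 'a \<Rightarrow> real" where
  "push f x = (\<lambda>q\<in>P. \<Sum>p\<in>P. if f p = q then x p else 0)"

text \<open>At time \<open>t\<close> the top part of mass \<open>t\<close> of the chain carrying \<open>x\<close> is mapped by \<open>g\<close> and the rest
  by \<open>f\<close>; as \<open>f \<le> g\<close>, the image is carried by a chain.\<close>

lemma homotopic_push:
  assumes f: "\<And>p. p \<in> P \<Longrightarrow> f p \<in> P" "\<And>p q. p \<in> P \<Longrightarrow> q \<in> P \<Longrightarrow> le p q \<Longrightarrow> le (f p) (f q)"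
    and g: "\<And>p. p \<in> P \<Longrightarrow> g p \<in> P" "\<And>p q. p \<in> P \<Longrightarrow> q \<in> P \<Longrightarrow> le p q \<Longrightarrow> le (g p) (g q)"
    and fg: "\<And>p. p \<in> P \<Longrightarrow> le (f p) (g p)"
  shows "homotopic_with (\<lambda>h. True) realization realization (push f) (push g)"
proof -
  \<comment> \<open>Stack the masses along the chain from the top down: \<open>p\<close> occupies
    the heights from \<open>above x p\<close> to \<open>above x p + x p\<close>, and
    \<open>w t x p\<close> is the length of the part up to \<open>t\<close>.\<close>
  define above where "above x p = (\<Sum>r | r \<in> P \<and> le p r \<and> r \<noteq> p. x r)" for x :: "'a \<Rightarrow> real" and p
  define w where "w t x p = max 0 (min (x p) (t - above x p))" for t and x :: "'a \<Rightarrow> real" and p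
  define h where "h = (\<lambda>(t, x). \<lambda>q\<in>P. \<Sum>p\<in>P. (if f p = q then x p - w t x p else 0)
    + (if g p = q then w t x p else 0))"
  let ?X = "prod_topology (top_of_set {0..1}) realization"
  have snd_cont: "continuous_map ?X euclideanreal (\<lambda>z. snd z p)" if "p \<in> P" for p
    using continuous_map_compose[OF continuous_map_snd continuous_map_coordinate[OF that]]
    by (simp add: o_def)
  have fst_cont: "continuous_map ?X euclideanreal fst"
    using continuous_map_fst[of "top_of_set {0..1}" realization]
    by (rule continuous_map_into_fulltopology)
  have "continuous_map ?X euclideanreal (\<lambda>z. above (snd z) p)" for p
    unfolding above_def using finite_P snd_cont by (intro continuous_intros) auto
  then have w_cont: "continuous_map ?X euclideanreal (\<lambda>z. w (fst z) (snd z) p)" if "p \<in> P" for p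
    unfolding w_def using snd_cont that fst_cont by (intro continuous_intros) auto
  have "continuous_map ?X euclideanreal (\<lambda>z. h z q)" if q: "q \<in> P" for q
  proof -
    have "continuous_map ?X euclideanreal
      (\<lambda>z. \<Sum>p\<in>P. (if f p = q then snd z p - w (fst z) (snd z) p else 0)
        + (if g p = q then w (fst z) (snd z) p else 0))"
    proof (intro continuous_map_sum finite_P continuous_map_add)
      fix p assume p: "p \<in> P"
      show "continuous_map ?X euclideanreal (\<lambda>z. if f p = q then snd z p - w (fst z) (snd z) p else 0)"
        using continuous_map_diff[OF snd_cont[OF p] w_cont[OF p]] by (cases "f p = q") simp_all
      show "continuous_map ?X euclideanreal (\<lambda>z. if g p = q then w (fst z) (snd z) p else 0)"
        using w_cont[OF p] by (cases "g p = q") simp_all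
    qed
    then show ?thesis using q by (simp add: h_def case_prod_unfold)
  qed
  moreover have "h (t, x) \<in> topspace realization"
    if t: "0 \<le> t" "t \<le> 1" and x: "x \<in> topspace realization" for t x
  proof -
    have x0: "\<And>p. p \<in> P \<Longrightarrow> 0 \<le> x p" and x1: "sum x P = 1"
      and xc: "\<And>p q. p \<in> P \<Longrightarrow> q \<in> P \<Longrightarrow> x p \<noteq> 0 \<Longrightarrow> x q \<noteq> 0 \<Longrightarrow> le p q \<or> le q p"
      using x mem_realization by auto
    have w: "0 \<le> w t x p" "w t x p \<le> x p" if "p \<in> P" for p
      using x0[OF that] by (auto simp: w_def)
    have "(\<Sum>q\<in>P. h (t, x) q) = (\<Sum>p\<in>P. \<Sum>q\<in>P. (if f p = q then x p - w t x p else 0)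
        + (if g p = q then w t x p else 0))"
      unfolding h_def by (simp, rule sum.swap)
    also have "\<dots> = (\<Sum>p\<in>P. x p)"
      using f(1) g(1) finite_P by (intro sum.cong) (auto simp: sum.distrib)
    finally have "sum (h (t, x)) P = 1" using x1 by simp
    moreover have "0 \<le> h (t, x) q" if "q \<in> P" for q
      using that w by (auto simp: h_def intro!: sum_nonneg add_nonneg_nonneg)
    moreover have "le q q' \<or> le q' q" if q: "q \<in> P" "q' \<in> P" "h (t, x) q \<noteq> 0" "h (t, x) q' \<noteq> 0" for q q'
    proof -
      have *: "\<exists>p\<in>P. f p = q \<and> w t x p < x p \<or> g p = q \<and> 0 < w t x p" if "q \<in> P" "h (t, x) q \<noteq> 0" for q
      proof -
        have "\<exists>p\<in>P. (if f p = q then x p - w t x p else 0) + (if g p = q then w t x p else 0) \<noteq> 0"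
        proof -
          have "(\<Sum>p\<in>P. (if f p = q then x p - w t x p else 0) + (if g p = q then w t x p else 0)) \<noteq> 0"
            using that by (simp add: h_def)
          with sum.not_neutral_contains_not_neutral show ?thesis by blast
        qed
        then obtain p where p: "p \<in> P"
            "(if f p = q then x p - w t x p else 0) + (if g p = q then w t x p else 0) \<noteq> 0"
          by blast
        then have "f p = q \<and> w t x p \<noteq> x p \<or> g p = q \<and> w t x p \<noteq> 0" by (auto split: if_splits)
        then show ?thesis using w[OF p(1)] p(1) by force
      qed
      have fg_comp: "le (f p) (g p')"
        if p: "p \<in> P" "p' \<in> P" "w t x p < x p" "0 < w t x p'" for p p'
      proof -
        have "x p \<noteq> 0" "x p' \<noteq> 0" using w[OF p(1)] w[OF p(2)] p by auto
        then consider "le p p'" | "le p' p" "p \<noteq> p'" using xc p le_refl by blast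
        then show ?thesis
        proof cases
          case 1
          show ?thesis
            by (rule le_trans[OF f(1)[OF p(1)] f(1)[OF p(2)] g(1)[OF p(2)] f(2)[OF p(1,2) 1] fg[OF p(2)]])
        next
          case 2
          \<comment> \<open>If \<open>p'\<close> lies strictly below \<open>p\<close>, the whole
            block of \<open>p\<close> precedes that of \<open>p'\<close>. Once part of
            \<open>p'\<close> has moved, all of \<open>p\<close> has, against
            \<open>w t x p < x p\<close>.\<close>
          have "x p + above x p = (\<Sum>r \<in> insert p {r \<in> P. le p r \<and> r \<noteq> p}. x r)"
            using finite_P by (simp add: above_def)
          also have "\<dots> \<le> above x p'"
            unfolding above_def
          proof (rule sum_mono2)
            show "insert p {r \<in> P. le p r \<and> r \<noteq> p} \<subseteq> {r \<in> P. le p' r \<and> r \<noteq> p'}"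
              using 2 p le_trans[of p' p] le_antisym[of p p'] by auto
          qed (use finite_P x0 in auto)
          finally show ?thesis using p by (auto simp: w_def)
        qed
      qed
      obtain p where p: "p \<in> P" "f p = q \<and> w t x p < x p \<or> g p = q \<and> 0 < w t x p" using *[of q] q by auto
      obtain p' where p': "p' \<in> P" "f p' = q' \<and> w t x p' < x p' \<or> g p' = q' \<and> 0 < w t x p'" using *[of q'] q by auto
      have "x p \<noteq> 0" "x p' \<noteq> 0" using w p p' by fastforce+
      then have "le p p' \<or> le p' p" using xc p p' by blast
      then show ?thesis using p p' f(2) g(2) fg_comp by metis
    qed
    ultimately show ?thesis unfolding mem_realization by (auto simp: h_def)
  qed
  ultimately have cont: "continuous_map ?X realization h"
    unfolding continuous_map_realization_iff by auto
  have above0: "0 \<le> above x p" if "x \<in> topspace realization" for x p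
    using that unfolding mem_realization above_def by (auto intro: sum_nonneg)
  have above1: "x p + above x p \<le> 1" if "x \<in> topspace realization" "p \<in> P" for x p
  proof -
    have "x p + above x p = (\<Sum>r \<in> insert p {r \<in> P. le p r \<and> r \<noteq> p}. x r)"
      using finite_P by (simp add: above_def)
    also have "\<dots> \<le> sum x P"
      using that finite_P unfolding mem_realization by (intro sum_mono2) auto
    finally show ?thesis using that mem_realization by auto
  qed
  have "h (0, x) = push f x" if "x \<in> topspace realization" for x
  proof -
    have "w 0 x p = 0" for p using above0[OF that, of p] by (auto simp: w_def)
    then show ?thesis by (simp add: h_def push_def cong: if_cong)
  qed
  moreover have "h (1, x) = push g x" if "x \<in> topspace realization" for x
  proof -
    have "w 1 x p = x p" if "p \<in> P" for p
      using above1[OF \<open>x \<in> topspace realization\<close> that] that \<open>x \<in> topspace realization\<close>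
      by (auto simp: w_def mem_realization)
    then show ?thesis by (simp add: h_def push_def cong: if_cong)
  qed
  ultimately show ?thesis
    using cont by (subst homotopic_with) auto
qed

lemma push_id:
  assumes "x \<in> topspace realization"
  shows "push (\<lambda>p. p) x = x"
proof
  fix q
  show "push (\<lambda>p. p) x q = x q"
    using assms finite_P by (cases "q \<in> P") (auto simp: push_def mem_realization extensional_def)
qed

text \<open>The identity and the constant map \<open>j\<close> both dominate \<open>f\<close>, so
  both are homotopic to the map induced by \<open>f\<close>.\<close>

lemma contractible_realization:
  assumes f: "\<And>p. p \<in> P \<Longrightarrow> f p \<in> P" "\<And>p q. p \<in> P \<Longrightarrow> q \<in> P \<Longrightarrow> le p q \<Longrightarrow> le (f p) (f q)"
    and fp: "\<And>p. p \<in> P \<Longrightarrow> le (f p) p" and j: "j \<in> P" "\<And>p. p \<in> P \<Longrightarrow> le (f p) j"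
  shows "contractible_space realization"
proof -
  have 1: "homotopic_with (\<lambda>h. True) realization realization (push f) (push (\<lambda>p. p))"
    by (rule homotopic_push) (use assms in auto)
  have 2: "homotopic_with (\<lambda>h. True) realization realization (push f) (push (\<lambda>p. j))"
    by (rule homotopic_push) (use assms le_refl in auto)
  have "homotopic_with (\<lambda>h. True) realization realization (push (\<lambda>p. p)) (push (\<lambda>p. j))"
    using homotopic_with_trans[OF homotopic_with_symD[OF 1] 2] .
  moreover have "push (\<lambda>p. j) x = (\<lambda>q\<in>P. if j = q then 1 else 0)" if "x \<in> topspace realization" for x
  proof
    fix q
    show "push (\<lambda>p. j) x q = (\<lambda>q\<in>P. if j = q then 1 else 0) q"
      using that by (cases "j = q") (auto simp: push_def mem_realization)
  qed
  ultimately have "homotopic_with (\<lambda>h. True) realization realization id (\<lambda>x. \<lambda>q\<in>P. if j = q then 1 else 0)"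
    by (elim homotopic_with_eq) (simp_all add: push_id)
  then show ?thesis unfolding contractible_space_def by blast
qed

end

section \<open>The proper part of a Boolean lattice\<close>

text \<open>The unit sphere of the norm \<open>max - min\<close> on \<open>\<real>\<^sup>l\<close> modulo constant vectors.\<close>

definition spread_sphere :: "nat \<Rightarrow> (nat \<Rightarrow> real) topology" where
  "spread_sphere l = subtopology (powertop_real {..<l})
     {y. (\<forall>i<l. 0 \<le> y i \<and> y i \<le> 1) \<and> (\<exists>i<l. y i = 0) \<and> (\<exists>i<l. y i = 1)}"

lemma mem_spread_sphere:
  "y \<in> topspace (spread_sphere l) \<longleftrightarrow> y \<in> extensional {..<l} \<and>
     (\<forall>i<l. 0 \<le> y i \<and> y i \<le> 1) \<and> (\<exists>i<l. y i = 0) \<and> (\<exists>i<l. y i = 1)"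
  by (auto simp: spread_sphere_def PiE_iff)

lemma continuous_map_spread_sphere_iff:
  "continuous_map X (spread_sphere l) f \<longleftrightarrow>
     f ` topspace X \<subseteq> topspace (spread_sphere l) \<and> (\<forall>i<l. continuous_map X euclideanreal (\<lambda>x. f x i))"
  unfolding spread_sphere_def
  by (auto simp: continuous_map_in_subtopology continuous_map_componentwise image_subset_iff PiE_iff)

lemma continuous_map_spread_coordinate:
  "i < l \<Longrightarrow> continuous_map (spread_sphere l) euclideanreal (\<lambda>y. y i)"
  using continuous_map_spread_sphere_iff[of "spread_sphere l" l "\<lambda>y. y"] by simp

text \<open>These are unit spheres of two norms on the same space of vectors modulo constants, of
  dimension \<open>m + 1\<close>. \<open>F\<close> chooses representatives with last coordinate 0
  and Euclidean norm 1, \<open>G\<close> those with minimum 0 and maximum 1.\<close>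

lemma spread_sphere_homeomorphic_nsphere:
  "spread_sphere (Suc (Suc m)) homeomorphic_space nsphere m"
proof -
  define l where "l = Suc (Suc m)"
  define N where "N y = sqrt (\<Sum>j\<le>m. (y j - y (Suc m))\<^sup>2)" for y :: "nat \<Rightarrow> real"
  define F where "F y i = (if i \<le> m then (y i - y (Suc m)) / N y else 0)" for y :: "nat \<Rightarrow> real" and i
  define mn where "mn x = Min (x ` {..<l})" for x :: "nat \<Rightarrow> real"
  define mx where "mx x = Max (x ` {..<l})" for x :: "nat \<Rightarrow> real"
  define G where "G x = (\<lambda>i\<in>{..<l}. (x i - mn x) / (mx x - mn x))" for x :: "nat \<Rightarrow> real"
  have N0: "0 < N y" if y: "y \<in> topspace (spread_sphere l)" for y
  proof -
    obtain i k where ik: "i < l" "y i = 0" "k < l" "y k = 1"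
      using y unfolding mem_spread_sphere by blast
    have "\<exists>j\<le>m. y j \<noteq> y (Suc m)"
    proof (rule ccontr)
      assume "\<not> (\<exists>j\<le>m. y j \<noteq> y (Suc m))"
      then have "y j = y (Suc m)" if "j < l" for j
        using that by (cases "j = Suc m") (auto simp: l_def)
      then show False using ik by (metis zero_neq_one)
    qed
    then obtain j where "j \<le> m" "y j \<noteq> y (Suc m)" by blast
    then have "0 < (\<Sum>j\<le>m. (y j - y (Suc m))\<^sup>2)"
      by (intro sum_pos2[of _ j]) auto
    then show ?thesis by (simp add: N_def)
  qed
  have Fi: "F y i = (y i - y (Suc m)) / N y" if "i < l" for y i
    using that by (cases "i = Suc m") (auto simp: F_def l_def)
  have Fmem: "F y \<in> topspace (nsphere m)" if y: "y \<in> topspace (spread_sphere l)" for y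
  proof -
    have "(\<Sum>i\<le>m. (F y i)\<^sup>2) = (\<Sum>i\<le>m. (y i - y (Suc m))\<^sup>2) / (N y)\<^sup>2"
      by (simp add: F_def power_divide sum_divide_distrib)
    also have "(\<Sum>i\<le>m. (y i - y (Suc m))\<^sup>2) = (N y)\<^sup>2"
      by (simp add: N_def sum_nonneg)
    finally have "(\<Sum>i\<le>m. (F y i)\<^sup>2) = 1" using N0[OF y] by simp
    then show ?thesis by (simp add: nsphere F_def)
  qed
  have img: "finite (x ` {..<l})" "x ` {..<l} \<noteq> {}" for x :: "nat \<Rightarrow> real" by (auto simp: l_def)
  have mn_le: "mn x \<le> x i" and mx_ge: "x i \<le> mx x" if "i < l" for x i
    using that by (auto simp: mn_def mx_def)
  have mn_ex: "\<exists>i<l. x i = mn x" and mx_ex: "\<exists>i<l. x i = mx x" for x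
    using Min_in[OF img[of x]] Max_in[OF img[of x]] by (auto simp: mn_def mx_def)
  have sph: "(\<Sum>i\<le>m. (x i)\<^sup>2) = 1" "x (Suc m) = 0" "\<And>i. i > m \<Longrightarrow> x i = 0"
    if "x \<in> topspace (nsphere m)" for x
    using that by (auto simp: nsphere)
  have width: "mn x < mx x" if x: "x \<in> topspace (nsphere m)" for x
  proof (rule ccontr)
    assume "\<not> mn x < mx x"
    then have "x i = x (Suc m)" if "i < l" for i
      using mn_le[of i x] mx_ge[of i x] mn_le[of "Suc m" x] mx_ge[of "Suc m" x] that by (simp add: l_def)
    then have "(\<Sum>i\<le>m. (x i)\<^sup>2) = 0" using sph[OF x] by (simp add: l_def)
    then show False using sph[OF x] by simp
  qed
  have Gmem: "G x \<in> topspace (spread_sphere l)" if x: "x \<in> topspace (nsphere m)" for x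
    unfolding mem_spread_sphere
  proof (intro conjI allI impI)
    show "\<exists>i<l. G x i = 0" using mn_ex[of x] by (auto simp: G_def)
    obtain i where "i < l" "x i = mx x" using mx_ex by blast
    then show "\<exists>i<l. G x i = 1" using width[OF x] by (intro exI[of _ i]) (auto simp: G_def)
  qed (use width[OF x] mn_le[of _ x] mx_ge[of _ x] in \<open>auto simp: G_def\<close>)
  have "continuous_map (spread_sphere l) (nsphere m) F"
  proof -
    note coord = continuous_map_spread_coordinate[of _ l]
    have diff: "continuous_map (spread_sphere l) euclideanreal (\<lambda>y. y i - y (Suc m))" if "i \<le> m" for i
      using that by (intro continuous_map_diff coord) (auto simp: l_def)
    have "continuous_map (spread_sphere l) euclideanreal (\<lambda>y. \<Sum>j\<le>m. (y j - y (Suc m))\<^sup>2)"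
      by (intro continuous_map_sum continuous_map_real_pow diff) auto
    moreover have "continuous_map euclideanreal euclideanreal sqrt"
      by (simp add: continuous_on_real_sqrt)
    ultimately have Nc: "continuous_map (spread_sphere l) euclideanreal N"
      unfolding N_def using continuous_map_compose[of _ euclideanreal _ euclideanreal sqrt] by (simp add: o_def)
    have "continuous_map (spread_sphere l) euclideanreal (\<lambda>y. F y i)" for i
    proof (cases "i \<le> m")
      case True
      have "continuous_map (spread_sphere l) euclideanreal (\<lambda>y. (y i - y (Suc m)) / N y)"
        by (intro continuous_map_real_divide diff True Nc) (use N0 in fastforce)
      then show ?thesis using True by (simp add: F_def)
    qed (simp add: F_def)
    then show ?thesis
      using Fmem unfolding nsphere
      by (auto simp: continuous_map_in_subtopology continuous_map_componentwise_UNIV)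
  qed
  moreover have "continuous_map (nsphere m) (spread_sphere l) G"
  proof -
    have c: "continuous_map (nsphere m) euclideanreal mn" "continuous_map (nsphere m) euclideanreal mx"
      unfolding mn_def mx_def
      by (rule continuous_map_Min continuous_map_Max; auto simp: l_def continuous_map_nsphere_projection)+
    have "continuous_map (nsphere m) euclideanreal (\<lambda>x. (x i - mn x) / (mx x - mn x))" for i
      using c width by (intro continuous_intros continuous_map_nsphere_projection) (auto dest: width)
    then have "continuous_map (nsphere m) euclideanreal (\<lambda>x. G x i)" if "i < l" for i
      using that by (simp add: G_def)
    then show ?thesis
      using Gmem by (auto simp: continuous_map_spread_sphere_iff)
  qed
  moreover have "G (F y) = y" if y: "y \<in> topspace (spread_sphere l)" for y
  proof -
    have N: "0 < N y" by (rule N0[OF y])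
    obtain i k where ik: "i < l" "y i = 0" "k < l" "y k = 1" and y01: "\<And>j. j < l \<Longrightarrow> 0 \<le> y j \<and> y j \<le> 1"
      using y unfolding mem_spread_sphere by blast
    have mn: "mn (F y) = (0 - y (Suc m)) / N y"
      unfolding mn_def
      by (rule Min_eqI) (use ik y01 Fi N in \<open>auto simp: divide_simps image_iff intro!: bexI[of _ i]\<close>)
    have mx: "mx (F y) = (1 - y (Suc m)) / N y"
      unfolding mx_def
      by (rule Max_eqI) (use ik y01 Fi N in \<open>auto simp: divide_simps image_iff intro!: bexI[of _ k]\<close>)
    have "mx (F y) - mn (F y) = 1 / N y"
      by (simp add: mn mx diff_divide_distrib)
    moreover have "F y j - mn (F y) = y j / N y" if "j < l" for j
      using that by (simp add: Fi mn diff_divide_distrib)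
    ultimately have "G (F y) j = y j" if "j < l" for j
      using that N by (simp add: G_def)
    moreover have "G (F y) j = y j" if "\<not> j < l" for j
      using that y by (simp add: G_def mem_spread_sphere extensional_def)
    ultimately show ?thesis by blast
  qed
  moreover have "F (G x) = x" if x: "x \<in> topspace (nsphere m)" for x
  proof -
    define w where "w = mx x - mn x"
    have w: "0 < w" using width[OF x] by (simp add: w_def)
    have d: "G x i - G x (Suc m) = x i / w" if "i \<le> m" for i
      using that sph[OF x] by (simp add: G_def l_def w_def diff_divide_distrib)
    have "(\<Sum>j\<le>m. (G x j - G x (Suc m))\<^sup>2) = 1 / w\<^sup>2"
      using d sph[OF x] by (simp add: power_divide sum_divide_distrib[symmetric])
    then have "N (G x) = 1 / w" using w by (simp add: N_def real_sqrt_divide)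
    then show ?thesis using d sph[OF x] w by (auto simp: F_def fun_eq_iff)
  qed
  ultimately show ?thesis
    unfolding homeomorphic_space_def homeomorphic_maps_def l_def[symmetric] by blast
qed

section \<open>Level sets and barycentric coordinates\<close>

definition proper_subsets :: "nat \<Rightarrow> nat set set" where
  "proper_subsets l = Pow {..<l} - {{}, {..<l}}"

text \<open>The length of the set of thresholds \<open>t\<close> for which \<open>A\<close> is the level set \<open>{i. t \<le> y i}\<close>.\<close>

definition level_gap :: "nat \<Rightarrow> (nat \<Rightarrow> real) \<Rightarrow> nat set \<Rightarrow> real" where
  "level_gap l y A = max 0 (Min (y ` A) - Max (y ` ({..<l} - A)))"

lemma finite_proper_subsets: "finite (proper_subsets l)"
  by (simp add: proper_subsets_def)

lemma proper_subsetsD: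
  assumes "A \<in> proper_subsets l"
  shows "finite A" "A \<noteq> {}" "A \<subseteq> {..<l}" "{..<l} - A \<noteq> {}"
proof -
  show A: "A \<noteq> {}" "A \<subseteq> {..<l}" "{..<l} - A \<noteq> {}"
    using assms by (auto simp: proper_subsets_def)
  show "finite A" using A(2) finite_subset by blast
qed

lemma level_gap_extremes:
  assumes "A \<in> proper_subsets l"
  shows "\<exists>i k. i \<in> A \<and> y i = Min (y ` A) \<and> (\<forall>i'\<in>A. y i \<le> y i') \<and>
    k \<in> {..<l} - A \<and> y k = Max (y ` ({..<l} - A)) \<and> (\<forall>k'\<in>{..<l} - A. y k' \<le> y k)"
proof -
  note A = proper_subsetsD[OF assms]
  have "Min (y ` A) \<in> y ` A" using A by (intro Min_in) auto
  then obtain i where i: "i \<in> A" "y i = Min (y ` A)" by auto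
  have "Max (y ` ({..<l} - A)) \<in> y ` ({..<l} - A)" using A(4) by (intro Max_in) auto
  then obtain k where k: "k \<in> {..<l} - A" "y k = Max (y ` ({..<l} - A))" by auto
  have "\<forall>i'\<in>A. y i \<le> y i'" using A(1) i by simp
  moreover have "\<forall>k'\<in>{..<l} - A. y k' \<le> y k" using k by simp
  ultimately show ?thesis using i k by blast
qed

lemma level_gap_pos_iff:
  assumes "A \<in> proper_subsets l"
  shows "0 < level_gap l y A \<longleftrightarrow> (\<forall>i\<in>A. \<forall>k\<in>{..<l} - A. y k < y i)"
proof -
  obtain i k where ik: "i \<in> A" "y i = Min (y ` A)" "\<And>i'. i' \<in> A \<Longrightarrow> y i \<le> y i'"
    "k \<in> {..<l} - A" "y k = Max (y ` ({..<l} - A))" "\<And>k'. k' \<in> {..<l} - A \<Longrightarrow> y k' \<le> y k"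
    using level_gap_extremes[OF assms, of y] by blast
  have "0 < level_gap l y A \<longleftrightarrow> y k < y i"
    by (simp add: level_gap_def ik(2)[symmetric] ik(5)[symmetric] less_max_iff_disj)
  then show ?thesis using ik by (meson le_less_trans less_le_trans)
qed

lemma level_gap_nonneg: "0 \<le> level_gap l y A"
  by (simp add: level_gap_def)

lemma level_gap_comparable:
  assumes "A \<in> proper_subsets l" "B \<in> proper_subsets l"
    and "0 < level_gap l y A" "0 < level_gap l y B"
  shows "A \<subseteq> B \<or> B \<subseteq> A"
proof (rule ccontr)
  assume "\<not> (A \<subseteq> B \<or> B \<subseteq> A)"
  then obtain i k where ik: "i \<in> A" "i \<notin> B" "k \<in> B" "k \<notin> A" by blast
  then have "i \<in> {..<l} - B" "k \<in> {..<l} - A"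
    using proper_subsetsD(3)[OF assms(1)] proper_subsetsD(3)[OF assms(2)] by blast+
  then have "y k < y i" "y i < y k"
    using assms(3,4) ik unfolding level_gap_pos_iff[OF assms(1)] level_gap_pos_iff[OF assms(2)] by blast+
  then show False by simp
qed

text \<open>A layer-cake formula. For \<open>0 < t \<le> y i\<close> the level set at
  \<open>t\<close> contains \<open>i\<close>, and it is proper because \<open>y\<close> vanishes
  somewhere. So the threshold intervals of the proper subsets containing \<open>i\<close> partition
  \<open>{0<..y i}\<close>, and their lengths add up.\<close>

lemma sum_level_gap:
  assumes y: "y \<in> topspace (spread_sphere l)" and i: "i < l"
  shows "(\<Sum>A\<in>proper_subsets l. if i \<in> A then level_gap l y A else 0) = y i"
proof -
  obtain k0 where k0: "k0 < l" "y k0 = 0" using y by (auto simp: mem_spread_sphere)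
  have y0: "0 \<le> y k" if "k < l" for k using y that by (auto simp: mem_spread_sphere)
  \<comment> \<open>Half-open on the left because level sets are defined by
    \<open>t \<le> y k\<close>; this makes the intervals disjoint.\<close>
  define J where "J A = {Max (y ` ({..<l} - A)) <.. Min (y ` A)}" for A
  let ?F = "{A \<in> proper_subsets l. i \<in> A}"
  have J: "t \<in> J A \<longleftrightarrow> A = {k. k < l \<and> t \<le> y k}" if A: "A \<in> proper_subsets l" for A t
  proof
    obtain i k where ik: "i \<in> A" "y i = Min (y ` A)" "\<And>i'. i' \<in> A \<Longrightarrow> y i \<le> y i'"
      "k \<in> {..<l} - A" "y k = Max (y ` ({..<l} - A))" "\<And>k'. k' \<in> {..<l} - A \<Longrightarrow> y k' \<le> y k"
      using level_gap_extremes[OF A, of y] by blast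
    have Jeq: "t \<in> J A \<longleftrightarrow> y k < t \<and> t \<le> y i" by (simp add: J_def ik(2) ik(5))
    show "A = {k. k < l \<and> t \<le> y k}" if "t \<in> J A"
      using that ik(3,6) proper_subsetsD(3)[OF A] unfolding Jeq by force
    show "t \<in> J A" if "A = {k. k < l \<and> t \<le> y k}"
      using ik(1,4) unfolding Jeq by (subst (asm) (1 2) that) auto
  qed
  have "(\<Sum>A\<in>proper_subsets l. if i \<in> A then level_gap l y A else 0) = (\<Sum>A\<in>?F. level_gap l y A)"
    by (simp add: sum.inter_filter finite_proper_subsets)
  also have "\<dots> = (\<Sum>A\<in>?F. measure lborel (J A))"
  proof (intro sum.cong refl)
    show "level_gap l y A = measure lborel (J A)" for A
      unfolding J_def level_gap_def
      by (cases "Max (y ` ({..<l} - A)) \<le> Min (y ` A)") (simp_all add: max_def)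
  qed
  also have "\<dots> = measure lborel (\<Union>A\<in>?F. J A)"
  proof (rule measure_finite_Union[symmetric])
    show "disjoint_family_on J ?F" using J by (auto simp: disjoint_family_on_def)
    show "emeasure lborel (J A) \<noteq> \<infinity>" for A
      unfolding J_def by (cases "Max (y ` ({..<l} - A)) \<le> Min (y ` A)") auto
  qed (auto simp: finite_proper_subsets J_def)
  also have "(\<Union>A\<in>?F. J A) = {0<..y i}"
  proof (intro subset_antisym subsetI)
    fix t assume "t \<in> (\<Union>A\<in>?F. J A)"
    then obtain A where A: "A \<in> proper_subsets l" "i \<in> A" "A = {k. k < l \<and> t \<le> y k}" using J by blast
    moreover have "0 < t"
    proof (rule ccontr)
      assume "\<not> 0 < t"
      then have "A = {..<l}" using A(3) y0 by force
      then show False using proper_subsetsD(4)[OF A(1)] by blast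
    qed
    ultimately show "t \<in> {0<..y i}" by auto
  next
    fix t assume t: "t \<in> {0<..y i}"
    define A where "A = {k. k < l \<and> t \<le> y k}"
    have "i \<in> A" "k0 \<notin> A" using t i k0 by (auto simp: A_def)
    moreover have "A \<subseteq> {..<l}" by (auto simp: A_def)
    ultimately have "A \<in> proper_subsets l" using k0(1) unfolding proper_subsets_def by blast
    moreover from this have "t \<in> J A" using J[of A t] A_def by blast
    ultimately show "t \<in> (\<Union>A\<in>?F. J A)" using \<open>i \<in> A\<close> by blast
  qed
  also have "measure lborel {0<..y i} = y i" using y0[OF i] by simp
  finally show ?thesis .
qed

text \<open>A coordinate with \<open>y i = 1\<close> belongs to every set of positive gap, so
  \<open>sum_level_gap\<close> at \<open>i\<close> gives the total.\<close>

lemma sum_level_gap_total: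
  assumes y: "y \<in> topspace (spread_sphere l)"
  shows "(\<Sum>A\<in>proper_subsets l. level_gap l y A) = 1"
proof -
  obtain i where i: "i < l" "y i = 1" using y by (auto simp: mem_spread_sphere)
  have "level_gap l y A = (if i \<in> A then level_gap l y A else 0)" if A: "A \<in> proper_subsets l" for A
  proof (cases "i \<in> A")
    case False
    obtain k where k: "k \<in> A" using proper_subsetsD(2)[OF A] by blast
    then have "k < l" using proper_subsetsD(3)[OF A] by auto
    then have "y k \<le> y i" using y i by (auto simp: mem_spread_sphere)
    then have "\<not> 0 < level_gap l y A"
      unfolding level_gap_pos_iff[OF A] using False k i by (meson Diff_iff lessThan_iff not_less)
    then show ?thesis using False level_gap_nonneg[of l y A] by simp
  qed simp
  then have "(\<Sum>A\<in>proper_subsets l. level_gap l y A) =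
      (\<Sum>A\<in>proper_subsets l. if i \<in> A then level_gap l y A else 0)" by (rule sum.cong[OF refl])
  then show ?thesis using sum_level_gap[OF y i(1)] i by simp
qed

text \<open>Let \<open>i\<close> attain the minimum of \<open>y\<close> on \<open>A\<close> and
  \<open>k\<close> its maximum outside. In \<open>y i - y k\<close> only the sets containing exactly
  one of \<open>i\<close> and \<open>k\<close> contribute, and along the chain \<open>A\<close> is
  the only such set.\<close>

lemma level_gap_unique:
  assumes z0: "\<And>A. A \<in> proper_subsets l \<Longrightarrow> 0 \<le> z A"
    and chain: "\<And>A B. A \<in> proper_subsets l \<Longrightarrow> B \<in> proper_subsets l \<Longrightarrow> z A \<noteq> 0 \<Longrightarrow> z B \<noteq> 0 \<Longrightarrow>
      A \<subseteq> B \<or> B \<subseteq> A"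
    and y: "\<And>i. i < l \<Longrightarrow> y i = (\<Sum>A\<in>proper_subsets l. if i \<in> A then z A else 0)"
    and A: "A \<in> proper_subsets l"
  shows "level_gap l y A = z A"
proof -
  have pos: "0 < level_gap l y B" if B: "B \<in> proper_subsets l" "z B \<noteq> 0" for B
    unfolding level_gap_pos_iff[OF B(1)]
  proof (intro ballI)
    fix i k assume ik: "i \<in> B" "k \<in> {..<l} - B"
    have "i < l" using ik(1) proper_subsetsD(3)[OF B(1)] by auto
    have "(\<Sum>C\<in>proper_subsets l. if k \<in> C then z C else 0) < (\<Sum>C\<in>proper_subsets l. if i \<in> C then z C else 0)"
    proof (rule sum_strict_mono_ex1[OF finite_proper_subsets])
      show "\<forall>C\<in>proper_subsets l. (if k \<in> C then z C else 0) \<le> (if i \<in> C then z C else 0)"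
      proof
        fix C assume C: "C \<in> proper_subsets l"
        show "(if k \<in> C then z C else 0) \<le> (if i \<in> C then z C else 0)"
          using chain[OF C B(1)] B(2) ik z0[OF C] by (cases "z C = 0") auto
      qed
      show "\<exists>C\<in>proper_subsets l. (if k \<in> C then z C else 0) < (if i \<in> C then z C else 0)"
        using ik B z0[OF B(1)] by (intro bexI[of _ B]) auto
    qed
    then show "y k < y i" using y \<open>i < l\<close> ik by simp
  qed
  show ?thesis
  proof (cases "0 < level_gap l y A")
    case False
    then show ?thesis using pos[OF A] level_gap_nonneg[of l y A] by force
  next
    case True
    obtain i k where ik: "i \<in> A" "y i = Min (y ` A)" "\<And>i'. i' \<in> A \<Longrightarrow> y i \<le> y i'"
      "k \<in> {..<l} - A" "y k = Max (y ` ({..<l} - A))" "\<And>k'. k' \<in> {..<l} - A \<Longrightarrow> y k' \<le> y k"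
      using level_gap_extremes[OF A, of y] by blast
    have "i < l" "k < l" using ik proper_subsetsD(3)[OF A] by auto
    have only: "(if i \<in> B then z B else 0) - (if k \<in> B then z B else 0) = (if B = A then z A else 0)"
      if B: "B \<in> proper_subsets l" for B
    proof (cases "z B = 0 \<or> B = A")
      case False
      then have Bpos: "\<And>i k. i \<in> B \<Longrightarrow> k \<in> {..<l} - B \<Longrightarrow> y k < y i"
        using pos[OF B] unfolding level_gap_pos_iff[OF B] by auto
      have "A \<subseteq> B \<or> B \<subseteq> A"
        using level_gap_comparable[OF A B True] pos[OF B] False by auto
      then have "i \<in> B \<longleftrightarrow> k \<in> B"
      proof
        assume "A \<subseteq> B"
        then obtain m where m: "m \<in> B" "m \<notin> A" using False by blast
        then have "m < l" using proper_subsetsD(3)[OF B] by auto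
        then have "y m \<le> y k" using ik(6) m by auto
        then have "k \<in> B" using Bpos[OF m(1), of k] \<open>k < l\<close> by force
        then show ?thesis using \<open>A \<subseteq> B\<close> ik(1) by blast
      next
        assume "B \<subseteq> A"
        then obtain m where m: "m \<in> A" "m \<notin> B" using False by blast
        then have "m < l" using proper_subsetsD(3)[OF A] by auto
        then have "i \<notin> B" using Bpos[of i m] ik(3)[OF m(1)] m by force
        then show ?thesis using \<open>B \<subseteq> A\<close> ik(4) by blast
      qed
      then show ?thesis using False by auto
    qed (use ik in auto)
    have "level_gap l y A = y i - y k"
      using True unfolding level_gap_def ik(2)[symmetric] ik(5)[symmetric] by simp
    also have "\<dots> = (\<Sum>B\<in>proper_subsets l. if B = A then z A else 0)"
      using y[OF \<open>i < l\<close>] y[OF \<open>k < l\<close>] only by (simp add: sum_subtractf[symmetric])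
    also have "\<dots> = z A" using A by (simp add: finite_proper_subsets)
    finally show ?thesis .
  qed
qed

lemma continuous_map_level_gap:
  assumes "A \<in> proper_subsets l"
  shows "continuous_map (spread_sphere l) euclideanreal (\<lambda>y. level_gap l y A)"
proof -
  note A = proper_subsetsD[OF assms]
  have "continuous_map (spread_sphere l) euclideanreal (\<lambda>y. Min ((\<lambda>i. y i) ` A))"
    using A by (intro continuous_map_Min[where f = "\<lambda>i y. y i"] continuous_map_spread_coordinate) auto
  moreover have "continuous_map (spread_sphere l) euclideanreal (\<lambda>y. Max ((\<lambda>i. y i) ` ({..<l} - A)))"
    using A by (intro continuous_map_Max[where f = "\<lambda>i y. y i"] continuous_map_spread_coordinate) auto
  ultimately show ?thesis
    unfolding level_gap_def by (intro continuous_map_real_max continuous_map_diff) simp_all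
qed

text \<open>\<open>join \<circ> supp\<close> is an interior operator on \<open>P\<close> whose image
  is a copy of the proper part of the Boolean lattice on \<open>l\<close> atoms.\<close>

locale boolean_order = finite_order P le for P :: "'a set" and le +
  fixes l :: nat and supp :: "'a \<Rightarrow> nat set" and join :: "nat set \<Rightarrow> 'a"
  assumes supp_proper: "p \<in> P \<Longrightarrow> supp p \<in> proper_subsets l"
    and supp_mono: "p \<in> P \<Longrightarrow> q \<in> P \<Longrightarrow> le p q \<Longrightarrow> supp p \<subseteq> supp q"
    and join_mem: "A \<in> proper_subsets l \<Longrightarrow> join A \<in> P"
    and join_mono: "A \<in> proper_subsets l \<Longrightarrow> B \<in> proper_subsets l \<Longrightarrow> A \<subseteq> B \<Longrightarrow> le (join A) (join B)"
    and supp_join: "A \<in> proper_subsets l \<Longrightarrow> supp (join A) = A"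
    and join_supp: "p \<in> P \<Longrightarrow> le (join (supp p)) p"
begin

text \<open>The map, affine on simplices, that sends a vertex \<open>p\<close> to the indicator
  function of \<open>supp p\<close>.\<close>

definition to_sphere :: "('a \<Rightarrow> real) \<Rightarrow> nat \<Rightarrow> real" where
  "to_sphere x = (\<lambda>i\<in>{..<l}. \<Sum>p\<in>P. if i \<in> supp p then x p else 0)"

text \<open>The gaps of \<open>y\<close> serve as barycentric coordinates on the chain of its level
  sets.\<close>

definition from_sphere :: "(nat \<Rightarrow> real) \<Rightarrow> 'a \<Rightarrow> real" where
  "from_sphere y = (\<lambda>p\<in>P. \<Sum>A\<in>proper_subsets l. if join A = p then level_gap l y A else 0)"

lemma to_sphere_mem:
  assumes x: "x \<in> topspace realization"
  shows "to_sphere x \<in> topspace (spread_sphere l)"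
proof -
  have x0: "\<And>p. p \<in> P \<Longrightarrow> 0 \<le> x p" and x1: "sum x P = 1"
    and xc: "\<And>p q. p \<in> P \<Longrightarrow> q \<in> P \<Longrightarrow> x p \<noteq> 0 \<Longrightarrow> x q \<noteq> 0 \<Longrightarrow> le p q \<or> le q p"
    using x mem_realization by auto
  define C where "C = {p \<in> P. x p \<noteq> 0}"
  have C: "finite C" "C \<noteq> {}"
    using finite_P x1 by (auto simp: C_def) (metis (mono_tags, lifting) sum.neutral zero_neq_one)
  have comp: "supp p \<subseteq> supp q \<or> supp q \<subseteq> supp p" if "p \<in> C" "q \<in> C" for p q
    using that xc supp_mono unfolding C_def by blast
  have finsupp: "finite (supp p)" if "p \<in> C" for p
    using that supp_proper proper_subsetsD(1) by (auto simp: C_def)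
  \<comment> \<open>The smallest and the largest support along the chain: coordinates inside the
    former get the full mass 1, coordinates outside the latter get 0.\<close>
  define lo where "lo = arg_min_on (\<lambda>p. card (supp p)) C"
  define hi where "hi = arg_min_on (\<lambda>p. l - card (supp p)) C"
  have lo: "lo \<in> C" "\<And>p. p \<in> C \<Longrightarrow> card (supp lo) \<le> card (supp p)"
    unfolding lo_def using arg_min_if_finite[OF C, of "\<lambda>p. card (supp p)"] by (auto simp: not_less)
  have hi: "hi \<in> C" "\<And>p. p \<in> C \<Longrightarrow> l - card (supp hi) \<le> l - card (supp p)"
    unfolding hi_def using arg_min_if_finite[OF C, of "\<lambda>p. l - card (supp p)"] by (auto simp: not_less)
  have card_le: "card (supp p) \<le> l" if "p \<in> C" for p
    using that supp_proper proper_subsetsD(3)[of "supp p" l] card_mono[of "{..<l}" "supp p"]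
    by (auto simp: C_def)
  have lo_min: "supp lo \<subseteq> supp p" if "p \<in> C" for p
    using comp[OF lo(1) that] lo(2)[OF that] card_seteq[OF finsupp[OF lo(1)], of "supp p"] by auto
  have hi_max: "supp p \<subseteq> supp hi" if "p \<in> C" for p
  proof -
    have "card (supp p) \<le> card (supp hi)"
      using hi(2)[OF that] card_le[OF that] card_le[OF hi(1)] by linarith
    then show ?thesis
      using comp[OF hi(1) that] card_seteq[OF finsupp[OF that], of "supp hi"] by auto
  qed
  obtain i where i: "i \<in> supp lo" "i < l"
    using supp_proper[of lo] proper_subsetsD[of "supp lo" l] lo(1) by (auto simp: C_def)
  obtain k where k: "k \<notin> supp hi" "k < l"
    using supp_proper[of hi] proper_subsetsD[of "supp hi" l] hi(1) by (auto simp: C_def)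
  have "(\<Sum>p\<in>P. if i \<in> supp p then x p else 0) = sum x P"
    using lo_min i by (intro sum.cong) (auto simp: C_def)
  moreover have "(\<Sum>p\<in>P. if k \<in> supp p then x p else 0) = 0"
    using hi_max k by (intro sum.neutral) (auto simp: C_def)
  moreover have "(\<Sum>p\<in>P. if m \<in> supp p then x p else 0) \<le> sum x P" for m
    using x0 by (intro sum_mono) auto
  moreover have "0 \<le> (\<Sum>p\<in>P. if m \<in> supp p then x p else 0)" for m
    using x0 by (intro sum_nonneg) auto
  ultimately show ?thesis
    unfolding mem_spread_sphere using i k x1 by (auto simp: to_sphere_def)
qed

lemma from_sphere_mem:
  assumes y: "y \<in> topspace (spread_sphere l)"
  shows "from_sphere y \<in> topspace realization"
  unfolding mem_realization
proof (intro conjI ballI impI)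
  show "from_sphere y \<in> extensional P" by (simp add: from_sphere_def)
  show "0 \<le> from_sphere y p" if "p \<in> P" for p
    using that level_gap_nonneg by (auto simp: from_sphere_def intro!: sum_nonneg)
  have "sum (from_sphere y) P = (\<Sum>A\<in>proper_subsets l. \<Sum>p\<in>P. if join A = p then level_gap l y A else 0)"
    unfolding from_sphere_def by (simp, rule sum.swap)
  also have "\<dots> = (\<Sum>A\<in>proper_subsets l. level_gap l y A)"
    using finite_P join_mem by (intro sum.cong) auto
  finally show "sum (from_sphere y) P = 1" using sum_level_gap_total[OF y] by simp
  fix p q assume pq: "p \<in> P" "q \<in> P" "from_sphere y p \<noteq> 0 \<and> from_sphere y q \<noteq> 0"
  have *: "\<exists>A\<in>proper_subsets l. join A = p \<and> 0 < level_gap l y A" if "p \<in> P" "from_sphere y p \<noteq> 0" for p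
  proof -
    have "(\<Sum>A\<in>proper_subsets l. if join A = p then level_gap l y A else 0) \<noteq> 0"
      using that by (simp add: from_sphere_def)
    then obtain A where "A \<in> proper_subsets l" "(if join A = p then level_gap l y A else 0) \<noteq> 0"
      by (rule sum.not_neutral_contains_not_neutral)
    then show ?thesis using level_gap_nonneg[of l y A] by (intro bexI[of _ A]) (auto split: if_splits)
  qed
  obtain A where A: "A \<in> proper_subsets l" "join A = p" "0 < level_gap l y A" using *[of p] pq by blast
  obtain B where B: "B \<in> proper_subsets l" "join B = q" "0 < level_gap l y B" using *[of q] pq by blast
  show "le p q \<or> le q p"
    using level_gap_comparable[OF A(1) B(1) A(3) B(3)] join_mono[OF A(1) B(1)] join_mono[OF B(1) A(1)] A B
    by auto
qed

lemma to_from_sphere: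
  assumes y: "y \<in> topspace (spread_sphere l)"
  shows "to_sphere (from_sphere y) = y"
proof
  fix i
  show "to_sphere (from_sphere y) i = y i"
  proof (cases "i < l")
    case True
    have "to_sphere (from_sphere y) i = (\<Sum>p\<in>P. \<Sum>A\<in>proper_subsets l.
        if i \<in> supp p then if join A = p then level_gap l y A else 0 else 0)"
      using True by (auto simp: to_sphere_def from_sphere_def intro!: sum.cong)
    also have "\<dots> = (\<Sum>A\<in>proper_subsets l. \<Sum>p\<in>P.
        if join A = p then if i \<in> supp (join A) then level_gap l y A else 0 else 0)"
      by (subst sum.swap, intro sum.cong) auto
    also have "\<dots> = (\<Sum>A\<in>proper_subsets l. if i \<in> A then level_gap l y A else 0)"
      using finite_P join_mem supp_join by (intro sum.cong) auto
    finally show ?thesis using sum_level_gap[OF y True] by simp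
  qed (use y in \<open>auto simp: to_sphere_def mem_spread_sphere extensional_def\<close>)
qed

lemma from_to_sphere:
  assumes x: "x \<in> topspace realization"
  shows "from_sphere (to_sphere x) = push (\<lambda>p. join (supp p)) x"
proof -
  have x0: "\<And>p. p \<in> P \<Longrightarrow> 0 \<le> x p"
    and xc: "\<And>p q. p \<in> P \<Longrightarrow> q \<in> P \<Longrightarrow> x p \<noteq> 0 \<Longrightarrow> x q \<noteq> 0 \<Longrightarrow> le p q \<or> le q p"
    using x mem_realization by auto
  \<comment> \<open>The mass collected by support. It lives on a chain of sets, so
    \<open>level_gap_unique\<close> recovers it from \<open>to_sphere x\<close>.\<close>
  define z where "z A = (\<Sum>p\<in>P. if supp p = A then x p else 0)" for A
  have zD: "\<exists>p\<in>P. supp p = A \<and> x p \<noteq> 0" if "z A \<noteq> 0" for A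
  proof (rule ccontr)
    assume "\<not> (\<exists>p\<in>P. supp p = A \<and> x p \<noteq> 0)"
    then have "z A = 0" unfolding z_def by (intro sum.neutral) auto
    then show False using that by simp
  qed
  have gap: "level_gap l (to_sphere x) A = z A" if A: "A \<in> proper_subsets l" for A
  proof (rule level_gap_unique[OF _ _ _ A])
    show "0 \<le> z B" for B using x0 by (auto simp: z_def intro!: sum_nonneg)
    show "B \<subseteq> C \<or> C \<subseteq> B" if "z B \<noteq> 0" "z C \<noteq> 0" for B C
      using zD[OF that(1)] zD[OF that(2)] xc supp_mono by metis
    fix i assume i: "i < l"
    have "(\<Sum>A\<in>proper_subsets l. if i \<in> A then z A else 0) = (\<Sum>A\<in>proper_subsets l. \<Sum>p\<in>P.
        if supp p = A then if i \<in> supp p then x p else 0 else 0)"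
    proof (intro sum.cong refl)
      fix A
      have "(\<Sum>p\<in>P. if supp p = A then if i \<in> supp p then x p else 0 else 0) =
          (\<Sum>p\<in>P. if i \<in> A then if supp p = A then x p else 0 else 0)"
        by (intro sum.cong) auto
      then show "(if i \<in> A then z A else 0) =
          (\<Sum>p\<in>P. if supp p = A then if i \<in> supp p then x p else 0 else 0)"
        by (simp add: z_def)
    qed
    also have "\<dots> = (\<Sum>p\<in>P. \<Sum>A\<in>proper_subsets l.
        if supp p = A then if i \<in> supp p then x p else 0 else 0)"
      by (rule sum.swap)
    also have "\<dots> = (\<Sum>p\<in>P. if i \<in> supp p then x p else 0)"
      using finite_proper_subsets supp_proper by (intro sum.cong) auto
    finally show "to_sphere x i = (\<Sum>A\<in>proper_subsets l. if i \<in> A then z A else 0)"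
      using i by (simp add: to_sphere_def)
  qed
  have "from_sphere (to_sphere x) q = push (\<lambda>p. join (supp p)) x q" for q
  proof (cases "q \<in> P")
    case True
    have "from_sphere (to_sphere x) q = (\<Sum>A\<in>proper_subsets l. if join A = q then z A else 0)"
      using True gap by (simp add: from_sphere_def cong: if_cong)
    also have "\<dots> = (\<Sum>A\<in>proper_subsets l. \<Sum>p\<in>P.
        if supp p = A then if join (supp p) = q then x p else 0 else 0)"
    proof (intro sum.cong refl)
      fix A
      have "(\<Sum>p\<in>P. if supp p = A then if join (supp p) = q then x p else 0 else 0) =
          (\<Sum>p\<in>P. if join A = q then if supp p = A then x p else 0 else 0)"
        by (intro sum.cong) auto
      then show "(if join A = q then z A else 0) =
          (\<Sum>p\<in>P. if supp p = A then if join (supp p) = q then x p else 0 else 0)"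
        by (simp add: z_def)
    qed
    also have "\<dots> = (\<Sum>p\<in>P. \<Sum>A\<in>proper_subsets l.
        if supp p = A then if join (supp p) = q then x p else 0 else 0)"
      by (rule sum.swap)
    also have "\<dots> = (\<Sum>p\<in>P. if join (supp p) = q then x p else 0)"
      using finite_proper_subsets supp_proper by (intro sum.cong) auto
    finally show ?thesis using True by (simp add: push_def)
  qed (simp add: from_sphere_def push_def)
  then show ?thesis by blast
qed

text \<open>One composite is the identity on the nose; the other is induced by
  \<open>join \<circ> supp\<close>, which lies below the identity.\<close>

lemma realization_homotopy_equivalent_spread_sphere:
  "realization homotopy_equivalent_space spread_sphere l"
proof -
  have to: "continuous_map realization (spread_sphere l) to_sphere"
    unfolding continuous_map_spread_sphere_iff
  proof (intro conjI allI impI)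
    fix i assume i: "i < l"
    have "continuous_map realization euclideanreal (\<lambda>x. \<Sum>p\<in>P. if i \<in> supp p then x p else 0)"
    proof (intro continuous_map_sum finite_P)
      fix p assume "p \<in> P"
      then show "continuous_map realization euclideanreal (\<lambda>x. if i \<in> supp p then x p else 0)"
        by (cases "i \<in> supp p") (simp_all add: continuous_map_coordinate)
    qed
    then show "continuous_map realization euclideanreal (\<lambda>x. to_sphere x i)"
      using i by (simp add: to_sphere_def)
  qed (use to_sphere_mem in auto)
  have from': "continuous_map (spread_sphere l) realization from_sphere"
    unfolding continuous_map_realization_iff
  proof (intro conjI ballI)
    fix p assume p: "p \<in> P"
    have "continuous_map (spread_sphere l) euclideanreal
      (\<lambda>y. \<Sum>A\<in>proper_subsets l. if join A = p then level_gap l y A else 0)"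
    proof (intro continuous_map_sum finite_proper_subsets)
      fix A assume "A \<in> proper_subsets l"
      then show "continuous_map (spread_sphere l) euclideanreal (\<lambda>y. if join A = p then level_gap l y A else 0)"
        by (cases "join A = p") (simp_all add: continuous_map_level_gap)
    qed
    then show "continuous_map (spread_sphere l) euclideanreal (\<lambda>y. from_sphere y p)"
      using p by (simp add: from_sphere_def)
  qed (use from_sphere_mem in auto)
  have "homotopic_with (\<lambda>h. True) realization realization (push (\<lambda>p. join (supp p))) (push (\<lambda>p. p))"
    by (rule homotopic_push) (simp_all add: join_mem supp_proper join_mono supp_mono join_supp le_refl)
  then have "homotopic_with (\<lambda>h. True) realization realization (from_sphere \<circ> to_sphere) id"
    by (elim homotopic_with_eq) (simp_all add: push_id from_to_sphere)
  moreover have "homotopic_with (\<lambda>h. True) (spread_sphere l) (spread_sphere l) (to_sphere \<circ> from_sphere) id"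
    by (rule homotopic_with_equal) (use to_from_sphere continuous_map_compose[OF from' to] in auto)
  ultimately show ?thesis
    unfolding homotopy_equivalent_space_def using to from' by blast
qed

end

section \<open>Homotopy spheres\<close>

lemma continuous_map_into_empty:
  assumes "continuous_map X trivial_topology f"
  shows "topspace X = {}"
proof (rule equals0I)
  fix x assume "x \<in> topspace X"
  then have "f x \<in> topspace trivial_topology" using assms unfolding continuous_map_def by blast
  then show False by simp
qed

text \<open>Reduced homology in degree \<open>m\<close> separates the dimensions;
  \<open>d = -1\<close> is excluded since a nonempty space has no map to the empty one.\<close>

lemma homotopy_sphere_nsphere:
  assumes "X homotopy_equivalent_space nsphere m"
  shows "homotopy_sphere X d \<longleftrightarrow> d = int m"
proof
  assume d: "homotopy_sphere X d"
  then have eq: "nsphere m homotopy_equivalent_space sphere_space d"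
    using assms homotopy_equivalent_space_sym homotopy_eqv_trans
    unfolding homotopy_sphere_def by blast
  have "0 \<le> d"
  proof (rule ccontr)
    assume "\<not> 0 \<le> d"
    then have "nsphere m homotopy_equivalent_space (trivial_topology :: (nat \<Rightarrow> real) topology)"
      using eq by (simp add: sphere_space_def)
    then obtain f where "continuous_map (nsphere m) (trivial_topology :: (nat \<Rightarrow> real) topology) f"
      unfolding homotopy_equivalent_space_def by blast
    then show False using continuous_map_into_empty in_topspace_nsphere by blast
  qed
  then have "nsphere m homotopy_equivalent_space nsphere (nat d)"
    using eq by (simp add: sphere_space_def)
  then have "reduced_homology_group (int m) (nsphere m) \<cong> reduced_homology_group (int m) (nsphere (nat d))"
    by (rule homotopy_equivalent_space_imp_isomorphic_reduced_homology_groups)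
  then have "trivial_group (reduced_homology_group (int m) (nsphere m)) \<longleftrightarrow>
      trivial_group (reduced_homology_group (int m) (nsphere (nat d)))"
    by (intro isomorphic_group_triviality) auto
  then show "d = int m"
    using \<open>0 \<le> d\<close> by (simp add: trivial_reduced_homology_group_nsphere)
next
  assume "d = int m"
  then show "homotopy_sphere X d" using assms by (simp add: homotopy_sphere_def sphere_space_def)
qed

lemma homotopy_sphere_empty:
  assumes "topspace X = {}"
  shows "homotopy_sphere X d \<longleftrightarrow> d = -1"
proof
  assume d: "homotopy_sphere X d"
  have "\<not> 0 \<le> d"
  proof
    assume "0 \<le> d"
    then have "X homotopy_equivalent_space nsphere (nat d)"
      using d by (simp add: homotopy_sphere_def sphere_space_def)
    then obtain g where "continuous_map (nsphere (nat d)) X g"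
      unfolding homotopy_equivalent_space_def by blast
    then show False using assms in_topspace_nsphere unfolding continuous_map_def by blast
  qed
  then show "d = -1" using d by (simp add: homotopy_sphere_def)
next
  assume "d = -1"
  moreover have "X = trivial_topology" using assms by simp
  ultimately show "homotopy_sphere X d"
    unfolding homotopy_sphere_def sphere_space_def homotopy_equivalent_space_def
    by (auto simp: continuous_map_def homotopic_with)
qed

text \<open>Nonemptiness matters: the empty space is contractible and is also the sphere of
  dimension -1.\<close>

lemma not_homotopy_sphere_contractible:
  assumes "contractible_space X" "topspace X \<noteq> {}"
  shows "\<not> homotopy_sphere X d"
proof
  assume d: "homotopy_sphere X d"
  show False
  proof (cases "0 \<le> d")
    case True
    then have "X homotopy_equivalent_space nsphere (nat d)"
      using d by (simp add: homotopy_sphere_def sphere_space_def)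
    then show False
      using assms homotopy_equivalent_space_contractibility non_contractible_space_nsphere by blast
  next
    case False
    then have "X homotopy_equivalent_space (trivial_topology :: (nat \<Rightarrow> real) topology)"
      using d by (simp add: homotopy_sphere_def sphere_space_def)
    then obtain f where "continuous_map X (trivial_topology :: (nat \<Rightarrow> real) topology) f"
      unfolding homotopy_equivalent_space_def by blast
    then show False using continuous_map_into_empty assms(2) by blast
  qed
qed

section \<open>Intervals of the weak order\<close>

theorem theorem3p23:
  fixes n :: nat and s :: "nat \<Rightarrow> nat" and T Z :: ltree and asc :: "(nat \<times> nat) list"
  assumes "decreasing_tree n s T" and "decreasing_tree n s Z"
    and "weak_less n s T Z"
    and "distinct asc"
    and "set asc = {(a, b). tree_ascent n s T (a, b) \<and> (b, a) \<in># tree_inv n s Z - tree_inv n s T}"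
  shows "((\<exists>d. homotopy_sphere (interval_complex n s T Z) d) \<longleftrightarrow>
          tree_inv n s Z =
            inv_tc n (foldl (inv_plus n s) (tree_inv n s T)
                       (map (\<lambda>p. mset_set (rotation_set n s T p)) asc)))
       \<and> (\<forall>d. homotopy_sphere (interval_complex n s T Z) d \<longrightarrow> d = int (length asc) - 2)"
proof -
  let ?A = "{1..n}" and ?I = "inv_num s T" and ?le = "weak_le n s"
  let ?M = "foldl (inv_plus n s) (tree_inv n s T) (map (\<lambda>p. mset_set (rotation_set n s T p)) asc)"
  note T = assms(1) and Z = assms(2)
  define l where "l = length asc"
  define R where "R i = inv_rotate ?I (fst (asc ! i)) (snd (asc ! i))" for i
  have I: "is_tree_inv ?A s ?I" by (rule decreasing_tree_is_tree_inv[OF T])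
  have TZ: "inv_le ?A ?I (inv_num s Z)" "T \<noteq> Z"
    using assms(3) by (auto simp: weak_less_def weak_le_iff)
  have set_asc: "(a, b) \<in> set asc \<longleftrightarrow> inv_ascent ?A s ?I a b \<and> ?I b a < inv_num s Z b a" for a b
  proof -
    have "(b, a) \<in># tree_inv n s Z - tree_inv n s T \<longleftrightarrow> ?I b a < inv_num s Z b a"
      if "inv_ascent ?A s ?I a b"
      using that unfolding in_diff_count count_tree_inv_Icc by (auto simp: inv_ascent_def inv_desc_def)
    then show ?thesis unfolding assms(5) using tree_ascent_iff[OF T] by auto
  qed
  have asc_nth: "inv_ascent ?A s ?I a b" "?I b a < inv_num s Z b a"
    if "i < l" "asc ! i = (a, b)" for i a b
    using set_asc[of a b] nth_mem[of i asc] that by (auto simp: l_def)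
  have R: "is_tree_inv ?A s (R i)" if "i < l" for i
    unfolding R_def using that asc_nth[of i] by (intro is_tree_inv_rotate[OF I]) simp
  have R_least: "inv_le ?A (R i) K"
    if "i < l" "asc ! i = (a, b)" "inv_trans ?A K" "inv_le ?A ?I K" "?I b a < K b a" for i a b K
    using inv_rotate_least[OF that(3,4), of a b] asc_nth(1)[OF that(1,2)] that
    by (simp add: R_def inv_ascent_def inv_desc_def)
  have RZ: "inv_le ?A (R i) (inv_num s Z)" if "i < l" for i
    using R_least[OF that _ is_tree_inv_imp_inv_trans[OF decreasing_tree_is_tree_inv[OF Z]] TZ(1)]
      asc_nth(2)[OF that] by (metis surj_pair)
  \<comment> \<open>For \<open>B = {}\<close> this is the least decreasing tree rather than
    \<open>T\<close>; membership in the interval is claimed only for nonempty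
    \<open>B\<close>.\<close>
  define join where "join B = tree_of n s (inv_join ?A s (R ` B))" for B
  have RB: "is_tree_inv ?A s K" if "B \<subseteq> {..<l}" "K \<in> R ` B" for B K
    using that R by auto
  have join_ti: "is_tree_inv ?A s (inv_join ?A s (R ` B))" if "B \<subseteq> {..<l}" for B
    using is_tree_inv_join[OF RB[OF that]] .
  have join_tree: "decreasing_tree n s (join B)" if "B \<subseteq> {..<l}" for B
    unfolding join_def using tree_of(1)[OF join_ti[OF that]] .
  have join_upper: "inv_le ?A (R i) (inv_num s (join B))" if "B \<subseteq> {..<l}" "i \<in> B" for B i
    unfolding join_def tree_of_le_iff[OF join_ti[OF that(1)]]
    using inv_join_upper[OF RB[OF that(1)]] that(2) by blast
  have join_least: "inv_le ?A (inv_num s (join B)) K"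
    if "B \<subseteq> {..<l}" "inv_trans ?A K" "\<And>i. i \<in> B \<Longrightarrow> inv_le ?A (R i) K" for B K
    unfolding join_def tree_of_le_iff[OF join_ti[OF that(1)]]
    by (rule inv_join_le[OF that(2) _ RB[OF that(1)]]) (use that(3) in auto)
  have tree_trans: "inv_trans ?A (inv_num s W)" if "decreasing_tree n s W" for W
    using is_tree_inv_imp_inv_trans[OF decreasing_tree_is_tree_inv[OF that]] .
  define supp where "supp W = {i. i < l \<and> inv_le ?A (R i) (inv_num s W)}" for W
  have supp_sub: "supp W \<subseteq> {..<l}" for W by (auto simp: supp_def)
  have join_supp: "?le (join (supp W)) W" if "decreasing_tree n s W" for W
    unfolding weak_le_iff by (rule join_least[OF supp_sub tree_trans[OF that]]) (simp add: supp_def)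
  have join_mono: "?le (join B) (join C)" if "B \<subseteq> C" "C \<subseteq> {..<l}" for B C
    unfolding weak_le_iff using that
    by (intro join_least tree_trans join_tree join_upper) auto
  have supp_mono: "supp V \<subseteq> supp W" if "?le V W" for V W
    using that inv_le_trans unfolding supp_def weak_le_iff by blast
  have supp_join: "supp (join B) = B" if B: "B \<subseteq> {..<l}" for B
  proof (intro subset_antisym subsetI)
    fix i assume "i \<in> supp (join B)"
    then have i: "i < l" "inv_le ?A (R i) (inv_num s (join B))" by (auto simp: supp_def)
    obtain a b where ab: "asc ! i = (a, b)" by (cases "asc ! i")
    note asc = asc_nth(1)[OF i(1) ab]
    show "i \<in> B"
    proof (rule ccontr)
      assume "i \<notin> B"
      then have "(a, b) \<notin> (!) asc ` B"
        using assms(4) ab i(1) B unfolding l_def by (auto simp: nth_eq_iff_index_eq subset_eq)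
      moreover have "inv_ascent ?A s ?I a' b'" if "(a', b') \<in> (!) asc ` B" for a' b'
        using that asc_nth(1) B by fastforce
      \<comment> \<open>\<open>K\<close> bounds every rotation indexed by \<open>B\<close>, hence
        their join, but keeps the value at \<open>(b, a)\<close> that \<open>R i\<close>
        raises.\<close>
      ultimately obtain K where K: "inv_trans ?A K" "K b a = ?I b a"
          "\<forall>(a', b')\<in>(!) asc ` B. inv_le ?A (inv_rotate ?I a' b') K"
        using inv_ascent_independent[OF I asc, of "(!) asc ` B"] by blast
      have "inv_le ?A (R j) K" if "j \<in> B" for j
        using K(3) that by (auto simp: R_def case_prod_unfold)
      then have "inv_le ?A (R i) K" using join_least[OF B K(1)] i(2) inv_le_trans by blast
      then have "R i b a \<le> K b a" using asc by (simp add: inv_le_def inv_ascent_def inv_desc_def)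
      then show False using K(2) ab by (simp add: R_def inv_rotate_def)
    qed
  next
    fix i assume "i \<in> B"
    then show "i \<in> supp (join B)" using join_upper[OF B] B by (auto simp: supp_def)
  qed
  \<comment> \<open>An ascent at which \<open>W\<close> exceeds \<open>T\<close> also has
    \<open>Z\<close> exceeding \<open>T\<close>, so it occurs in \<open>asc\<close>.\<close>
  have supp_ne: "supp W \<noteq> {}"
    if W: "decreasing_tree n s W" "?le T W" "T \<noteq> W" "?le W Z" for W
  proof -
    have "\<not> ?le W T" using weak_le_antisym[OF T W(1)] W(2,3) by blast
    then obtain a b where ab: "inv_ascent ?A s ?I a b" "?I b a < inv_num s W b a"
      using ex_inv_ascent[OF I decreasing_tree_is_tree_inv[OF W(1)]] W(2) unfolding weak_le_iff by auto
    moreover have "inv_num s W b a \<le> inv_num s Z b a"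
      using W(4) ab(1) by (simp add: weak_le_iff inv_le_def inv_ascent_def inv_desc_def)
    ultimately have "(a, b) \<in> set asc" unfolding set_asc by linarith
    then obtain i where i: "i < l" "asc ! i = (a, b)" by (auto simp: in_set_conv_nth l_def)
    have "i \<in> supp W"
      using R_least[OF i tree_trans[OF W(1)]] W(2) ab(2) i(1) by (simp add: supp_def weak_le_iff)
    then show ?thesis by blast
  qed
  have le_T: "?le T (join B)" "T \<noteq> join B" if B: "B \<subseteq> {..<l}" "B \<noteq> {}" for B
  proof -
    obtain i where i: "i \<in> B" using B(2) by blast
    have "inv_le ?A ?I (R i)" unfolding R_def by (rule inv_rotate_ge)
    then show "?le T (join B)" using join_upper[OF B(1) i] inv_le_trans unfolding weak_le_iff by blast
    show "T \<noteq> join B"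
    proof
      assume eq: "T = join B"
      obtain a b where ab: "asc ! i = (a, b)" by (cases "asc ! i")
      have "i < l" using i B(1) by auto
      note asc = asc_nth(1)[OF this ab]
      have "inv_le ?A (R i) ?I" using join_upper[OF B(1) i] eq by simp
      then have "R i b a \<le> ?I b a" using asc by (simp add: inv_le_def inv_ascent_def inv_desc_def)
      then show False using ab by (simp add: R_def inv_rotate_def)
    qed
  qed
  have le_Z: "?le (join B) Z" if "B \<subseteq> {..<l}" for B
    unfolding weak_le_iff using that RZ by (intro join_least tree_trans Z) auto
  have "supp Z \<noteq> {}" using supp_ne[OF Z] TZ by (auto simp: weak_le_iff inv_le_refl)
  then have l: "0 < l" by (auto simp: supp_def)
  let ?J = "join {..<l}"
  \<comment> \<open>\<open>?M\<close> is the pointwise maximum of the functions \<open>R i\<close>,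
    which uses \<open>0 < l\<close> at pairs raised by none of them. Its closure is therefore their
    join.\<close>
  have tc: "inv_tc n ?M = tree_inv n s ?J"
    unfolding join_def
  proof (rule inv_tc_tree_of[OF join_ti[OF order_refl]])
    have cM: "count ?M (y, x) = (if \<exists>i<l. R i y x \<noteq> ?I y x then ?I y x + 1 else ?I y x)"
      if xy: "x \<in> ?A" "y \<in> ?A" "x < y" for x y
    proof -
      have "(\<exists>(a, b)\<in>set asc. inv_rotate ?I a b y x \<noteq> ?I y x) \<longleftrightarrow> (\<exists>i<l. R i y x \<noteq> ?I y x)"
        unfolding R_def l_def by (force simp: in_set_conv_nth case_prod_unfold)
      then show ?thesis
        using count_foldl_rotation_sets[OF T _ assms(4) xy] set_asc by simp
    qed
    have R_cases: "R i y x = ?I y x \<or> R i y x = ?I y x + 1" for i x y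
      by (auto simp: R_def inv_rotate_def)
    show "multi_inv_set n ?M"
      by (cases asc rule: rev_cases) (simp_all add: multi_inv_set_inv_plus multi_inv_set_tree_inv)
    have up: "inv_le ?A (R i) (inv_join ?A s (R ` {..<l}))" if "i < l" for i
      using inv_join_upper[OF RB[OF order_refl]] that by blast
    show "inv_le ?A (\<lambda>y x. count ?M (y, x)) (inv_join ?A s (R ` {..<l}))"
      unfolding inv_le_def
    proof (intro ballI impI)
      fix y x assume xy: "y \<in> ?A" "x \<in> ?A" "x < y"
      have *: "R i y x \<le> inv_join ?A s (R ` {..<l}) y x" if "i < l" for i
        using up[OF that] xy by (simp add: inv_le_def)
      show "count ?M (y, x) \<le> inv_join ?A s (R ` {..<l}) y x"
      proof (cases "\<exists>i<l. R i y x \<noteq> ?I y x")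
        case True
        then obtain i where "i < l" "R i y x \<noteq> ?I y x" by blast
        then show ?thesis using *[of i] R_cases[of i y x] cM[OF xy(2,1,3)] True by auto
      next
        case False
        then show ?thesis using *[OF l] l cM[OF xy(2,1,3)] by auto
      qed
    qed
    fix K assume K: "inv_trans ?A K" "inv_le ?A (\<lambda>y x. count ?M (y, x)) K"
    have "inv_le ?A (R i) K" if i: "i < l" for i
      unfolding inv_le_def
    proof (intro ballI impI)
      fix y x assume xy: "y \<in> ?A" "x \<in> ?A" "x < y"
      have "R i y x \<le> count ?M (y, x)"
        using R_cases[of i y x] cM[OF xy(2,1,3)] i by (cases "R i y x = ?I y x") auto
      also have "\<dots> \<le> K y x" using K(2) xy by (simp add: inv_le_def)
      finally show "R i y x \<le> K y x" .
    qed
    then show "inv_le ?A (inv_join ?A s (R ` {..<l})) K"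
      by (intro inv_join_le[OF K(1) _ RB[OF order_refl]]) auto
  qed
  have inv_eq: "tree_inv n s Z = inv_tc n ?M \<longleftrightarrow> Z = ?J"
  proof
    assume "tree_inv n s Z = inv_tc n ?M"
    then show "Z = ?J"
      using weak_le_antisym[OF Z join_tree[OF order_refl]] by (simp add: tc weak_le_def)
  qed (simp add: tc)
  define P where "P = open_interval n s T Z"
  have P: "W \<in> P \<longleftrightarrow> decreasing_tree n s W \<and> ?le T W \<and> T \<noteq> W \<and> ?le W Z \<and> W \<noteq> Z" for W
    by (auto simp: P_def open_interval_def weak_less_def)
  interpret finite_order P ?le
  proof
    show "finite P"
      by (rule finite_subset[OF _ finite_decreasing_trees[of n s]]) (auto simp: P)
    show "?le W W" for W by (simp add: weak_le_def)
    show "?le U W" if "?le U V" "?le V W" for U V W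
      using that inv_le_trans unfolding weak_le_iff by blast
    show "V = W" if "V \<in> P" "W \<in> P" "?le V W" "?le W V" for V W
      using that weak_le_antisym by (auto simp: P)
  qed
  have complex: "interval_complex n s T Z = realization"
    by (simp add: interval_complex_def P_def)
  have P_supp: "supp W \<noteq> {}" if "W \<in> P" for W using that supp_ne by (auto simp: P)
  show ?thesis
  proof (cases "Z = ?J")
    case True
    \<comment> \<open>An element above all rotations lies above \<open>?J = Z\<close>, so it is not
      in the open interval.\<close>
    have full: "supp W \<noteq> {..<l}" if "W \<in> P" for W
    proof
      assume "supp W = {..<l}"
      moreover have W: "decreasing_tree n s W" "?le W Z" "W \<noteq> Z" using that by (simp_all add: P)
      ultimately have "?le Z W" using join_supp[OF W(1)] True by simp
      then show False using weak_le_antisym[OF W(1) Z W(2)] W(3) by simp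
    qed
    interpret boolean_order P ?le l supp join
    proof
      show "supp W \<in> proper_subsets l" if "W \<in> P" for W
        using P_supp[OF that] full[OF that] supp_sub by (auto simp: proper_subsets_def)
      show "join B \<in> P" if B: "B \<in> proper_subsets l" for B
      proof -
        have B': "B \<subseteq> {..<l}" "B \<noteq> {}" "B \<noteq> {..<l}" using B by (auto simp: proper_subsets_def)
        have "join B \<noteq> Z"
        proof
          assume "join B = Z"
          then have "supp (join B) = supp ?J" using True by simp
          then show False using supp_join[OF B'(1)] supp_join[OF order_refl] B'(3) by simp
        qed
        then show ?thesis using join_tree[OF B'(1)] le_T[OF B'(1,2)] le_Z[OF B'(1)] by (simp add: P)
      qed
      show "supp V \<subseteq> supp W" if "?le V W" for V W by (rule supp_mono[OF that])
      show "?le (join B) (join C)" if "C \<in> proper_subsets l" "B \<subseteq> C" for B C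
        by (rule join_mono[OF that(2) proper_subsetsD(3)[OF that(1)]])
      show "supp (join B) = B" if "B \<in> proper_subsets l" for B
        by (rule supp_join[OF proper_subsetsD(3)[OF that]])
      show "?le (join (supp W)) W" if "W \<in> P" for W
        using that by (intro join_supp) (simp add: P)
    qed
    have sphere: "homotopy_sphere realization d \<longleftrightarrow> d = int l - 2" for d
    proof (cases "l = 1")
      case True
      \<comment> \<open>With one atom the open interval is empty, and the value
        \<open>l - 2 = -1\<close> is the dimension of the empty sphere.\<close>
      then have "proper_subsets l = {}" by (auto simp: proper_subsets_def)
      then have "P = {}" using supp_proper by blast
      then show ?thesis
        using homotopy_sphere_empty[OF topspace_realization_empty] True by simp
    next
      case False
      then obtain m where m: "l = Suc (Suc m)" using l by (metis One_nat_def Suc_pred not0_implies_Suc)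
      have "realization homotopy_equivalent_space nsphere m"
        using homotopy_eqv_trans[OF realization_homotopy_equivalent_spread_sphere
            homeomorphic_imp_homotopy_equivalent_space] spread_sphere_homeomorphic_nsphere m by blast
      from homotopy_sphere_nsphere[OF this] show ?thesis by (simp add: m)
    qed
    show ?thesis unfolding complex inv_eq sphere l_def[symmetric] using True by blast
  next
    case False
    have JP: "?J \<in> P"
      using join_tree[OF order_refl] le_T[OF order_refl] le_Z[OF order_refl] False l by (auto simp: P)
    have "contractible_space realization"
    proof (rule contractible_realization)
      fix W assume W: "W \<in> P"
      have le: "?le (join (supp W)) W" using W join_supp by (simp add: P)
      moreover have "join (supp W) \<noteq> Z"
        using W le weak_le_antisym[OF Z, of W] by (auto simp: P)
      ultimately show "join (supp W) \<in> P"
        using join_tree[OF supp_sub] le_T[OF supp_sub P_supp[OF W]] le_Z[OF supp_sub] by (simp add: P)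
      show "?le (join (supp W)) W" by fact
      show "?le (join (supp W)) ?J" by (rule join_mono[OF supp_sub order_refl])
    next
      show "?le (join (supp V)) (join (supp W))" if "?le V W" for V W
        by (rule join_mono[OF supp_mono[OF that] supp_sub])
    qed (rule JP)
    moreover have "topspace realization \<noteq> {}" using topspace_realization_nonempty JP by blast
    ultimately have "\<not> homotopy_sphere realization d" for d
      by (rule not_homotopy_sphere_contractible)
    \<comment> \<open>The complex is a sphere of no dimension, so the claim about \<open>d\<close>
      holds vacuously.\<close>
    then show ?thesis unfolding complex inv_eq using False by blast
  qed
qed

end
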